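(* Let $T^3-AT+B$ be in standard form with $2\deg B>3\deg A$ and $3\nmid\deg(FI^2)$. Let $\mathfrak{a}_1,\mathfrak{a}_2$ be nonzero integral ideals of $\mathcal{O}_{\mathcal{F}}$. Put $\mathfrak{a}_3=\mathfrak{a}_1\mathfrak{a}_2$, let $s\in\mathbb{F}_q[x]$ be the monic generator of $\mathfrak{a}_3\cap\mathbb{F}_q[x]$, put $\overline{\mathfrak{a}_3}=\langle s\rangle\mathfrak{a}_3^{-1}$, let $\alpha\in\overline{\mathfrak{a}_3}$ be a nonzero element whose norm $N_{\mathcal{F}/\mathbb{F}_q(x)}(\alpha)$ has minimal degree among nonzero elements of $\overline{\mathfrak{a}_3}$, and put $J=\langle\alpha\rangle\,\overline{\mathfrak{a}_3}^{\,-1}$. Then $J$ is the distinguished ideal in the ideal class of $\mathfrak{a}_1\mathfrak{a}_2$.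
   Context: $q$ is a power of $3$. $A,B\in\mathbb{F}_q[x]$, $A\neq 0$, and $T^3-AT+B\in\mathbb{F}_q[x,T]$ is absolutely irreducible; $\mathcal{F}=\mathbb{F}_q(x,y)$ with $y^3-Ay+B=0$, and $\mathcal{O}_{\mathcal{F}}$ is the integral closure of $\mathbb{F}_q[x]$ in $\mathcal{F}$. $\langle\alpha\rangle$ denotes $\alpha\mathcal{O}_{\mathcal{F}}$. The polynomial $T^3-AT+B$ is in standard form if (a) there are no non-constant $Q\in\mathbb{F}_q[x]$ and $i\in\mathbb{F}_q[x]$ with $Q^2\mid A$ and $Q^3\mid i^3-iA+B$, and (b) either $3\nmid\deg B$ and $2\deg B>3\deg A$, or $2\deg B\le 3\deg A$. Index data: $I\in\mathbb{F}_q[x]$ is the (monic) index of $y$, i.e. $A^3=\mathrm{disc}(1,y,y^2)=I^2\,\mathrm{disc}(\mathcal{F})$ up to the square of a nonzero constant, where $\mathrm{disc}(\mathcal{F})$ is the discriminant of an $\mathbb{F}_q[x]$-basis of $\mathcal{O}_{\mathcal{F}}$. One has $I\mid A$, and $i\in\mathbb{F}_q[x]$ is fixed with $I^2\mid i^3-iA+B$; then $\{1,\ \rho=y-i,\ \omega=(y^2+iy+i^2-A)/I\}$ is an $\mathbb{F}_q[x]$-basis of $\mathcal{O}_{\mathcal{F}}$. Define $F\in\mathbb{F}_q[x]$ by $FI^2=i^3-iA+B$. Under the hypotheses there is a unique infinite place of $\mathcal{F}$, and it has degree $1$. A degree-zero divisor $D$ of $\mathcal{F}$ is finitely effective if its coefficients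 at all finite places (those not above the place $1/x$) are nonnegative. $D^+$ denotes the part of $D$ with positive coefficients. A finitely effective degree-zero divisor $D$ is distinguished if for every finitely effective degree-zero divisor $D_1$ linearly equivalent to $D$, $\deg D_1^+\le\deg D^+$ implies $D_1=D$. An integral ideal is distinguished if it is the image of the finite part of a distinguished divisor under $\sum_P n_PP\mapsto\prod_P(P\cap\mathcal{O}_{\mathcal{F}})^{n_P}$ (product over finite places). Equivalently, a nonzero integral ideal $J$ is distinguished if every nonzero integral ideal $J_1$ in its ideal class with $\deg N(J_1)\le\deg N(J)$ equals $J$, where $N(J)\in\mathbb{F}_q[x]$ is the ideal norm. *)

theory Defs
  imports "HOL-Analysis.Determinants" "HOL-Algebra.Algebraic_Closure_Type"
begin

section \<open>The defining cubic\<close>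

definition cubic :: "'k::field poly \<Rightarrow> 'k poly \<Rightarrow> 'k poly poly" where
  "cubic A B = [:B, - A, 0, 1:]"

definition absolutely_irreducible :: "'k::field poly poly \<Rightarrow> bool" where
  "absolutely_irreducible f \<longleftrightarrow>
     irreducible (map_poly (map_poly to_ac) f :: 'k alg_closure poly poly)"

definition standard_form :: "'k::field poly \<Rightarrow> 'k poly \<Rightarrow> bool" where
  "standard_form A B \<longleftrightarrow>
     \<not> (\<exists>Q i. degree Q > 0 \<and> Q ^ 2 dvd A \<and> Q ^ 3 dvd i ^ 3 - i * A + B) \<and>
     (\<not> 3 dvd degree B \<and> 2 * degree B > 3 * degree A \<or> 2 * degree B \<le> 3 * degree A)"


section \<open>The function field and its maximal order\<close>

text \<open>
  The rational function field is \<^typ>\<open>'k poly fract\<close>. The cubic function field is realised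
  inside the algebraic closure of the rational function field, as the subfield generated
  by a root \<open>y\<close> of the cubic.
\<close>

type_synonym 'k rf_closure = "'k poly fract alg_closure"

abbreviation of_rf :: "'k::field poly fract \<Rightarrow> 'k rf_closure" where
  "of_rf \<equiv> to_ac"

abbreviation of_pol :: "'k::field poly \<Rightarrow> 'k rf_closure" where
  "of_pol p \<equiv> to_ac (to_fract p)"

inductive_set function_field :: "'k::field rf_closure \<Rightarrow> 'k rf_closure set"
  for y :: "'k rf_closure" where
  base: "of_rf r \<in> function_field y"
| gen: "y \<in> function_field y"
| add: "u \<in> function_field y \<Longrightarrow> v \<in> function_field y \<Longrightarrow> u + v \<in> function_field y"
| uminus: "u \<in> function_field y \<Longrightarrow> - u \<in> function_field y"
| mult: "u \<in> function_field y \<Longrightarrow> v \<in> function_field y \<Longrightarrow> u * v \<in> function_field y"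
| inverse: "u \<in> function_field y \<Longrightarrow> inverse u \<in> function_field y"

definition max_order :: "'k::field rf_closure \<Rightarrow> 'k rf_closure set" where
  "max_order y = {z \<in> function_field y.
     \<exists>p :: 'k poly poly. lead_coeff p = 1 \<and> poly (map_poly of_pol p) z = 0}"


section \<open>Norm, trace and discriminant\<close>

definition power_basis :: "'k::field rf_closure \<Rightarrow> 'k rf_closure ^ 3" where
  "power_basis y = vector [1, y, y ^ 2]"

text \<open>Matrix of multiplication by \<open>z\<close> with respect to the basis \<open>1, y, y\<^sup>2\<close> over the rational
  function field.\<close>

definition mult_matrix :: "'k::field rf_closure \<Rightarrow> 'k rf_closure \<Rightarrow> 'k poly fract ^ 3 ^ 3" where
  "mult_matrix y z = (THE M. \<forall>i. z * power_basis y $ i = (\<Sum>j\<in>UNIV. of_rf (M $ i $ j) * power_basis y $ j))"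

definition field_norm :: "'k::field rf_closure \<Rightarrow> 'k rf_closure \<Rightarrow> 'k poly fract" where
  "field_norm y z = det (mult_matrix y z)"

definition field_trace :: "'k::field rf_closure \<Rightarrow> 'k rf_closure \<Rightarrow> 'k poly fract" where
  "field_trace y z = trace (mult_matrix y z)"

definition disc :: "'k::field rf_closure \<Rightarrow> 'k rf_closure ^ 3 \<Rightarrow> 'k poly fract" where
  "disc y b = det (\<chi> i j. field_trace y (b $ i * b $ j))"

text \<open>The degree of a nonzero rational function; the value at \<open>0\<close> is unspecified.\<close>

definition rf_degree :: "'k::field poly fract \<Rightarrow> int" where
  "rf_degree r = (THE d. \<exists>p q. p \<noteq> 0 \<and> q \<noteq> 0 \<and> r = Fract p q \<and> d = int (degree p) - int (degree q))"

definition is_pol_basis :: "'k::field rf_closure ^ 3 \<Rightarrow> 'k rf_closure set \<Rightarrow> bool" where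
  "is_pol_basis b S \<longleftrightarrow>
     S = range (\<lambda>c :: 'k poly ^ 3. \<Sum>j\<in>UNIV. of_pol (c $ j) * b $ j) \<and>
     (\<forall>c :: 'k poly ^ 3. (\<Sum>j\<in>UNIV. of_pol (c $ j) * b $ j) = 0 \<longrightarrow> c = 0)"

text \<open>The equation only determines \<open>I\<close> up to a constant factor, because the discriminants of two
  bases of the maximal order differ by the square of a nonzero constant; \<open>I\<close> is taken monic.\<close>

definition is_index :: "'k::field rf_closure \<Rightarrow> 'k poly \<Rightarrow> bool" where
  "is_index y I \<longleftrightarrow> lead_coeff I = 1 \<and>
     (\<exists>b c. is_pol_basis b (max_order y) \<and> c \<noteq> 0 \<and>
        disc y (power_basis y) = to_fract ([:c:] ^ 2 * I ^ 2) * disc y b)"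


section \<open>Ideals\<close>

definition nonzero_ideal :: "'k::field rf_closure \<Rightarrow> 'k rf_closure set \<Rightarrow> bool" where
  "nonzero_ideal y J \<longleftrightarrow> J \<subseteq> max_order y \<and> 0 \<in> J \<and>
     (\<forall>u\<in>J. \<forall>v\<in>J. u + v \<in> J) \<and> (\<forall>z\<in>max_order y. \<forall>u\<in>J. z * u \<in> J) \<and> J \<noteq> {0}"

text \<open>The following operations are used for integral and for fractional ideals.\<close>

definition principal :: "'k::field rf_closure \<Rightarrow> 'k rf_closure \<Rightarrow> 'k rf_closure set" where
  "principal y \<alpha> = (\<lambda>z. \<alpha> * z) ` max_order y"

definition ideal_mult :: "'k::field rf_closure set \<Rightarrow> 'k rf_closure set \<Rightarrow> 'k rf_closure set" where
  "ideal_mult I J = {\<Sum>k<n. f k * g k | (n::nat) f g. \<forall>k<n. f k \<in> I \<and> g k \<in> J}"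

definition ideal_inverse :: "'k::field rf_closure \<Rightarrow> 'k rf_closure set \<Rightarrow> 'k rf_closure set" where
  "ideal_inverse y J = {z \<in> function_field y. \<forall>u\<in>J. z * u \<in> max_order y}"

definition same_class :: "'k::field rf_closure \<Rightarrow> 'k rf_closure set \<Rightarrow> 'k rf_closure set \<Rightarrow> bool" where
  "same_class y I J \<longleftrightarrow> (\<exists>\<gamma>\<in>function_field y. \<gamma> \<noteq> 0 \<and> I = ideal_mult (principal y \<gamma>) J)"

text \<open>The monic polynomial which is, up to a constant factor, the determinant of the matrix
  expressing a basis of \<open>J\<close> in terms of a basis of the maximal order.\<close>

definition ideal_norm :: "'k::field rf_closure \<Rightarrow> 'k rf_closure set \<Rightarrow> 'k poly" where
  "ideal_norm y J = (THE n. lead_coeff n = 1 \<and>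
     (\<exists>b c (M :: 'k poly ^ 3 ^ 3) k. is_pol_basis b (max_order y) \<and> is_pol_basis c J \<and>
        (\<forall>i. c $ i = (\<Sum>j\<in>UNIV. of_pol (M $ i $ j) * b $ j)) \<and> det M = smult k n))"

text \<open>The ideal-theoretic form of the notion of a distinguished divisor; the infinite place of the
  fields considered is unique of degree one, so that a finitely effective divisor of degree zero
  is determined by its finite part.\<close>

definition distinguished :: "'k::field rf_closure \<Rightarrow> 'k rf_closure set \<Rightarrow> bool" where
  "distinguished y J \<longleftrightarrow> nonzero_ideal y J \<and>
     (\<forall>J\<^sub>1. nonzero_ideal y J\<^sub>1 \<and> same_class y J\<^sub>1 J \<and>
        degree (ideal_norm y J\<^sub>1) \<le> degree (ideal_norm y J) \<longrightarrow> J\<^sub>1 = J)"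

definition is_distinguished_ideal_of_class ::
    "'k::field rf_closure \<Rightarrow> 'k rf_closure set \<Rightarrow> 'k rf_closure set \<Rightarrow> bool" where
  "is_distinguished_ideal_of_class y J \<aa> \<longleftrightarrow> distinguished y J \<and> same_class y J \<aa> \<and>
     (\<forall>J'. distinguished y J' \<and> same_class y J' \<aa> \<longrightarrow> J' = J)"

end

theory Submission
  imports Defs
begin

text \<open>
  Why the theorem holds. Write \<open>\<aa>\<close> for \<open>\<aa>\<^sub>3\<close> and \<open>\<aa>'\<close> for \<open>\<langle>s\<rangle>\<aa>\<^sup>-\<^sup>1\<close>. Integral ideals in the class
  of \<open>\<aa>\<close> correspond to nonzero elements \<open>\<beta>\<close> of \<open>\<aa>'\<close> through \<open>\<beta> \<mapsto> \<langle>\<beta>\<rangle>\<aa>'\<^sup>-\<^sup>1\<close>, and the degree of the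
  ideal norm differs from the degree of the norm of \<open>\<beta>\<close> by a constant (lemma
  \<open>degree_ideal_norm_scale\<close>). Hence \<open>J\<close> has minimal norm degree in its class, and only
  uniqueness is at stake: another ideal of the same norm degree comes from an element \<open>\<beta>\<close> of \<open>\<aa>'\<close>
  with the same norm degree as \<open>\<alpha>\<close>. There is a single infinite place, totally ramified and thus of
  degree one, and the norm degree is minus the valuation there. So some constant multiple of \<open>\<alpha>\<close>
  cancels the leading term of \<open>\<beta>\<close>, and the difference, again in \<open>\<aa>'\<close>, has smaller norm degree
  (lemma \<open>norm_degree_cancel\<close>). Minimality makes it zero, so \<open>\<beta>\<close> and \<open>\<alpha>\<close> generate the same ideal.

  The valuation is never constructed. The norm of \<open>a + by + cy\<^sup>2\<close> is an explicit form whose three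
  pure terms \<open>a\<^sup>3\<close>, \<open>- b\<^sup>3B\<close>, \<open>c\<^sup>3B\<^sup>2\<close> have degrees in the three distinct classes
  modulo 3, because 3 does not divide the degree of \<open>B\<close>; as \<open>A\<close> has small degree, the
  mixed terms never reach the largest of them. So the degree of the norm is the largest of three weights
  (lemma \<open>norm_form_degree\<close>). This gives the cancellation, and also the linear independence
  of \<open>1, y, y\<^sup>2\<close> and the existence of inverses.

  The second ingredient is that \<open>\<aa>\<close> is invertible, needed in the form \<open>(\<aa>\<^sup>-\<^sup>1)\<^sup>-\<^sup>1 = \<aa>\<close>. It follows
  from integral closedness once every proper nonzero ideal \<open>H\<close> admits an element \<open>z\<close> outside the
  maximal order with \<open>zH\<close> inside it (lemma \<open>proper_ideal_inverse\<close>): apply this to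
  \<open>H = \<aa>\<aa>\<^sup>-\<^sup>1\<close>; if \<open>H\<close> were proper, \<open>z\<close> would stabilise the lattice \<open>\<aa>\<^sup>-\<^sup>1\<close> and so be integral. The
  element \<open>z\<close> is found by a finiteness argument: the residue ring modulo a nonzero polynomial is
  finite, so powers repeat, and a suitable element congruent to 1 modulo \<open>H\<close> annihilates high powers
  of all generators of \<open>H\<close>.
\<close>

text \<open>Only vector components are written with \<open>$\<close> here, not coefficients of power series.\<close>

no_notation fps_nth (infixl "$" 75)

section \<open>The degree of the norm form\<close>

text \<open>
  The norm of \<open>a + b y + c y\<^sup>2\<close> for a root \<open>y\<close> of \<open>T\<^sup>3 - A T + B\<close>; see \<open>det_mult_mat_poly\<close>.
\<close>

definition norm_form :: "'k::field poly \<Rightarrow> 'k poly \<Rightarrow> 'k poly \<Rightarrow> 'k poly \<Rightarrow> 'k poly \<Rightarrow> 'k poly" where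
  "norm_form A B a b c = a ^ 3 - b ^ 3 * B + c ^ 3 * B ^ 2
     + (2 * (a\<^sup>2 * c * A) + a * c\<^sup>2 * A\<^sup>2 - a * b\<^sup>2 * A + 3 * (a * b * c * B) + b * c\<^sup>2 * A * B)"

text \<open>
  The zero polynomial has degree 0 by convention, but must count as having degree \<open>-\<infinity>\<close> when leading
  terms are compared.
\<close>

definition below_degree :: "nat \<Rightarrow> 'k::field poly \<Rightarrow> bool" where
  "below_degree n p \<longleftrightarrow> p = 0 \<or> degree p < n"

lemma below_degreeI: "(p \<noteq> 0 \<Longrightarrow> degree p < n) \<Longrightarrow> below_degree n p"
  by (auto simp: below_degree_def)

lemma below_degree_0 [simp]: "below_degree n 0"
  by (simp add: below_degree_def)

lemma below_degree_add: "below_degree n p \<Longrightarrow> below_degree n q \<Longrightarrow> below_degree n (p + q)"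
  unfolding below_degree_def by (metis add.left_neutral add.right_neutral degree_add_less)

lemma below_degree_minus: "below_degree n p \<Longrightarrow> below_degree n (- p)"
  by (simp add: below_degree_def)

lemma below_degree_diff: "below_degree n p \<Longrightarrow> below_degree n q \<Longrightarrow> below_degree n (p - q)"
  by (metis add_uminus_conv_diff below_degree_add below_degree_minus)

lemma below_degree_numeral_mult: "below_degree n p \<Longrightarrow> below_degree n (numeral k * p)"
  using degree_smult_le[of "numeral k" p] unfolding below_degree_def
  by (auto simp: numeral_poly)

lemma degree_add_below_degree:
  assumes "p \<noteq> 0" "below_degree (degree p) r"
  shows "p + r \<noteq> 0" "degree (p + r) = degree p"
proof -
  have "degree (p + r) = degree p" 
    using assms by (auto simp: below_degree_def degree_add_eq_left)
  moreover have "p + r \<noteq> 0"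
    using assms by (auto simp: below_degree_def add_eq_0_iff)
  ultimately show "p + r \<noteq> 0" "degree (p + r) = degree p" by auto
qed

text \<open>
  With the place at infinity normalised so that \<open>x\<close> has weight 3, the element \<open>y\<close> has weight \<open>D\<close>,
  the degree of \<open>B\<close>. The predicate bounds the weights of the terms \<open>a\<close>, \<open>by\<close>, \<open>cy\<^sup>2\<close>.
\<close>

definition weight_below :: "nat \<Rightarrow> nat \<Rightarrow> 'k::field poly \<Rightarrow> 'k poly \<Rightarrow> 'k poly \<Rightarrow> bool" where
  "weight_below D n a b c \<longleftrightarrow>
     (a \<noteq> 0 \<longrightarrow> 3 * degree a < n) \<and> (b \<noteq> 0 \<longrightarrow> 3 * degree b + D < n) \<and>
     (c \<noteq> 0 \<longrightarrow> 3 * degree c + 2 * D < n)"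

text \<open>
  The weights of the terms lie in different classes modulo 3, so exactly one of the present terms has
  the largest weight \<open>w\<close>. Each mixed term of the norm form is bounded by a weighted mean of the weights
  (strictly, since either \<open>A\<close> occurs and \<open>3 deg A < 2D\<close>, or the weights averaged are distinct),
  so it stays below \<open>w\<close> and cannot disturb the one pure term of degree \<open>w\<close>.
\<close>

lemma norm_form_degree:
  assumes D: "\<not> 3 dvd degree B" and A: "3 * degree A < 2 * degree B"
    and nz: "a \<noteq> 0 \<or> b \<noteq> 0 \<or> c \<noteq> 0"
  shows "norm_form A B a b c \<noteq> 0"
    and "degree (norm_form A B a b c) < n \<longleftrightarrow> weight_below (degree B) n a b c"
proof -
  define D where "D = degree B"
  define w where "w = Max ({m. a \<noteq> 0 \<and> m = 3 * degree a} \<union> {m. b \<noteq> 0 \<and> m = 3 * degree b + D}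
                        \<union> {m. c \<noteq> 0 \<and> m = 3 * degree c + 2 * D})" (is "_ = Max ?S")
  have B0: "B \<noteq> 0" using D by auto
  have fin: "finite ?S" and ne: "?S \<noteq> {}" using nz by auto
  have win: "w \<in> ?S" unfolding w_def using Max_in[OF fin ne] .
  have wle: "m \<le> w" if "m \<in> ?S" for m unfolding w_def using Max_ge[OF fin that] .
  have wa: "3 * degree a \<le> w" if "a \<noteq> 0" using wle that by auto
  have wb: "3 * degree b + D \<le> w" if "b \<noteq> 0" using wle that by auto
  have wc: "3 * degree c + 2 * D \<le> w" if "c \<noteq> 0" using wle that by auto
  have neq: "3 * k \<noteq> 3 * l + D" "3 * k \<noteq> 3 * l + 2 * D" "3 * k + D \<noteq> 3 * l + 2 * D" for k l
    using D unfolding D_def by presburger+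
  have A': "3 * degree A < 2 * D" using A D_def by simp
  have dB: "degree B = D" by (simp add: D_def)
  define R where "R = 2 * (a\<^sup>2 * c * A) + a * c\<^sup>2 * A\<^sup>2 - a * b\<^sup>2 * A + 3 * (a * b * c * B) + b * c\<^sup>2 * A * B"
  have "below_degree w (a\<^sup>2 * c * A)"
  proof (rule below_degreeI)
    assume "a\<^sup>2 * c * A \<noteq> 0"
    hence n: "a \<noteq> 0" "c \<noteq> 0" "A \<noteq> 0" by auto
    show "degree (a\<^sup>2 * c * A) < w"
      using wa[OF n(1)] wc[OF n(2)] A' n by (simp add: degree_mult_eq degree_power_eq)
  qed
  moreover have "below_degree w (a * c\<^sup>2 * A\<^sup>2)"
  proof (rule below_degreeI)
    assume "a * c\<^sup>2 * A\<^sup>2 \<noteq> 0"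
    hence n: "a \<noteq> 0" "c \<noteq> 0" "A \<noteq> 0" by auto
    show "degree (a * c\<^sup>2 * A\<^sup>2) < w"
      using wa[OF n(1)] wc[OF n(2)] A' n by (simp add: degree_mult_eq degree_power_eq)
  qed
  moreover have "below_degree w (a * b\<^sup>2 * A)"
  proof (rule below_degreeI)
    assume "a * b\<^sup>2 * A \<noteq> 0"
    hence n: "a \<noteq> 0" "b \<noteq> 0" "A \<noteq> 0" by auto
    show "degree (a * b\<^sup>2 * A) < w"
      using wa[OF n(1)] wb[OF n(2)] A' n by (simp add: degree_mult_eq degree_power_eq)
  qed
  moreover have "below_degree w (a * b * c * B)"
  proof (rule below_degreeI)
    assume "a * b * c * B \<noteq> 0"
    hence n: "a \<noteq> 0" "b \<noteq> 0" "c \<noteq> 0" by auto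
    show "degree (a * b * c * B) < w"
      using wa[OF n(1)] wb[OF n(2)] wc[OF n(3)] neq(1)[of "degree a" "degree b"] n B0
      by (simp add: degree_mult_eq degree_power_eq dB)
  qed
  moreover have "below_degree w (b * c\<^sup>2 * A * B)"
  proof (rule below_degreeI)
    assume "b * c\<^sup>2 * A * B \<noteq> 0"
    hence n: "b \<noteq> 0" "c \<noteq> 0" "A \<noteq> 0" by auto
    show "degree (b * c\<^sup>2 * A * B) < w"
      using wb[OF n(1)] wc[OF n(2)] A' n B0 by (simp add: degree_mult_eq degree_power_eq dB)
  qed
  ultimately have R: "below_degree w R"
    unfolding R_def
    by (intro below_degree_add below_degree_diff below_degree_numeral_mult)
  let ?a = "a ^ 3" and ?b = "b ^ 3 * B" and ?c = "c ^ 3 * B ^ 2"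
  have da: "degree ?a = 3 * degree a" by (cases "a = 0") (auto simp: degree_power_eq)
  have db: "degree ?b = 3 * degree b + D" if "b \<noteq> 0"
    using that B0 by (simp add: degree_mult_eq degree_power_eq dB)
  have dc: "degree ?c = 3 * degree c + 2 * D" if "c \<noteq> 0"
    using that B0 by (simp add: degree_mult_eq degree_power_eq dB)
  have nf: "norm_form A B a b c = ?a - ?b + ?c + R" by (simp add: norm_form_def R_def)
  have main: "norm_form A B a b c \<noteq> 0 \<and> degree (norm_form A B a b c) = w"
  proof -
    consider "a \<noteq> 0" "w = 3 * degree a" | "b \<noteq> 0" "w = 3 * degree b + D"
      | "c \<noteq> 0" "w = 3 * degree c + 2 * D"
      using win by auto
    thus ?thesis
    proof cases
      case 1
      have "below_degree w ?b" using wb neq(1)[of "degree a" "degree b"] 1 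
        by (cases "b = 0") (auto simp: below_degree_def db)
      moreover have "below_degree w ?c" using wc neq(2)[of "degree a" "degree c"] 1 
        by (cases "c = 0") (auto simp: below_degree_def dc)
      ultimately have "below_degree (degree ?a) (- ?b + ?c + R)"
        using R 1 da by (intro below_degree_add below_degree_minus) auto
      from degree_add_below_degree[OF _ this] show ?thesis 
        using 1 da by (simp add: nf algebra_simps)
    next
      case 2
      have "below_degree w ?a" using wa neq(1)[of "degree a" "degree b"] 2 
        by (cases "a = 0") (auto simp: below_degree_def da)
      moreover have "below_degree w ?c" using wc neq(3)[of "degree b" "degree c"] 2 
        by (cases "c = 0") (auto simp: below_degree_def dc)
      ultimately have "below_degree (degree (- ?b)) (?a + ?c + R)"
        using R 2 db by (intro below_degree_add) auto
      from degree_add_below_degree[OF _ this] show ?thesis 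
        using 2 db B0 by (simp add: nf algebra_simps)
    next
      case 3
      have "below_degree w ?a" using wa neq(2)[of "degree a" "degree c"] 3 
        by (cases "a = 0") (auto simp: below_degree_def da)
      moreover have "below_degree w ?b" using wb neq(3)[of "degree b" "degree c"] 3 
        by (cases "b = 0") (auto simp: below_degree_def db)
      ultimately have "below_degree (degree ?c) (?a + - ?b + R)"
        using R 3 dc by (intro below_degree_add below_degree_minus) auto
      from degree_add_below_degree[OF _ this] show ?thesis 
        using 3 dc B0 by (simp add: nf algebra_simps)
    qed
  qed
  thus "norm_form A B a b c \<noteq> 0" by simp
  show "degree (norm_form A B a b c) < n \<longleftrightarrow> weight_below (degree B) n a b c"
    using main win wa wb wc unfolding weight_below_def D_def by force
qed

lemma lead_coeff_cancel:
  fixes p q :: "'k::field poly"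
  assumes "q \<noteq> 0" "degree p = degree q"
  shows "below_degree (degree q) (p - smult (lead_coeff p / lead_coeff q) q)"
proof -
  let ?r = "p - smult (lead_coeff p / lead_coeff q) q"
  have "coeff ?r (degree q) = 0" using assms by simp
  moreover have "degree ?r \<le> degree q"
    using assms degree_diff_le[of p "degree q" "smult (lead_coeff p / lead_coeff q) q"] by simp
  ultimately show ?thesis unfolding below_degree_def
    by (metis le_neq_implies_less leading_coeff_0_iff)
qed

text \<open>
  Equal norm degrees force the same term to dominate in both triples, because the class of the degree
  modulo 3 names that term. Its leading coefficients then differ by a constant; this is where the
  residue degree one of the infinite place enters.
\<close>

lemma norm_form_cancel:
  assumes D: "\<not> 3 dvd degree B" and A: "3 * degree A < 2 * degree B"
    and nz: "a \<noteq> 0 \<or> b \<noteq> 0 \<or> c \<noteq> 0" and nz': "a' \<noteq> 0 \<or> b' \<noteq> 0 \<or> c' \<noteq> 0"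
    and eq: "degree (norm_form A B a b c) = degree (norm_form A B a' b' c')"
  obtains k where "weight_below (degree B) (degree (norm_form A B a b c))
       (a - smult k a') (b - smult k b') (c - smult k c')"
proof -
  define D where "D = degree B"
  define n where "n = degree (norm_form A B a b c)"
  note nf = norm_form_degree[OF D A nz] and nf' = norm_form_degree[OF D A nz']
  have le: "weight_below D (Suc n) a b c" "\<not> weight_below D n a b c"
    using nf(2)[of "Suc n"] nf(2)[of n] by (auto simp: n_def D_def)
  have le': "weight_below D (Suc n) a' b' c'" "\<not> weight_below D n a' b' c'"
    using nf'(2)[of "Suc n"] nf'(2)[of n] eq by (auto simp: n_def D_def)
  have neq: "3 * k \<noteq> 3 * l + D" "3 * k \<noteq> 3 * l + 2 * D" "3 * k + D \<noteq> 3 * l + 2 * D" for k l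
    using D unfolding D_def by presburger+
  have comb: "below_degree m (p - smult k q)" if "below_degree m p" "below_degree m q" 
    for m k and p q :: "'a poly"
    using that by (intro below_degree_diff) 
      (auto simp: below_degree_def intro: order.strict_trans1[OF degree_smult_le])
  have low: "(p - smult k q \<noteq> 0 \<longrightarrow> 3 * degree (p - smult k q) + e < n)"
    if "p \<noteq> 0 \<longrightarrow> 3 * degree p + e < n" "q \<noteq> 0 \<longrightarrow> 3 * degree q + e < n" for p q :: "'a poly" and k e
  proof -
    (* chosen such that, for nonzero r, degree r < m means 3 * degree r + e < n *)
    define m where "m = (if e < n then Suc ((n - e - 1) div 3) else 0)"
    have eqv: "below_degree m r \<longleftrightarrow> (r \<noteq> 0 \<longrightarrow> 3 * degree r + e < n)" for r :: "'a poly"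
      unfolding below_degree_def m_def by auto
    show ?thesis using comb[of m p q k] that unfolding eqv .
  qed
  have top: "(p - smult (lead_coeff p / lead_coeff q) q \<noteq> 0 \<longrightarrow> 
     3 * degree (p - smult (lead_coeff p / lead_coeff q) q) + e < n)"
    if "3 * degree p + e = n" "q \<noteq> 0" "3 * degree q + e = n" for p q :: "'a poly" and e
    using lead_coeff_cancel[of q p] that by (auto simp: below_degree_def)
  note top0 = top[where e = 0, unfolded add_0_right] and low0 = low[where e = 0, unfolded add_0_right]
  consider 
      "a \<noteq> 0" "3 * degree a = n" "b \<noteq> 0 \<longrightarrow> 3 * degree b + D < n" "c \<noteq> 0 \<longrightarrow> 3 * degree c + 2 * D < n"
    | "b \<noteq> 0" "3 * degree b + D = n" "a \<noteq> 0 \<longrightarrow> 3 * degree a < n" "c \<noteq> 0 \<longrightarrow> 3 * degree c + 2 * D < n"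
    | "c \<noteq> 0" "3 * degree c + 2 * D = n" "a \<noteq> 0 \<longrightarrow> 3 * degree a < n" "b \<noteq> 0 \<longrightarrow> 3 * degree b + D < n"
    using le neq(1)[of "degree a" "degree b"] neq(2)[of "degree a" "degree c"] neq(3)[of "degree b" "degree c"]
    unfolding weight_below_def by linarith
  note cs = this
  consider 
      "a' \<noteq> 0" "3 * degree a' = n" "b' \<noteq> 0 \<longrightarrow> 3 * degree b' + D < n" "c' \<noteq> 0 \<longrightarrow> 3 * degree c' + 2 * D < n"
    | "b' \<noteq> 0" "3 * degree b' + D = n" "a' \<noteq> 0 \<longrightarrow> 3 * degree a' < n" "c' \<noteq> 0 \<longrightarrow> 3 * degree c' + 2 * D < n"
    | "c' \<noteq> 0" "3 * degree c' + 2 * D = n" "a' \<noteq> 0 \<longrightarrow> 3 * degree a' < n" "b' \<noteq> 0 \<longrightarrow> 3 * degree b' + D < n"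
    using le' neq(1)[of "degree a'" "degree b'"] neq(2)[of "degree a'" "degree c'"] neq(3)[of "degree b'" "degree c'"]
    unfolding weight_below_def by linarith
  note cs' = this
  have "\<exists>k. weight_below D n (a - smult k a') (b - smult k b') (c - smult k c')"
    using cs
  proof cases
    case 1
    hence c': "a' \<noteq> 0" "3 * degree a' = n" "b' \<noteq> 0 \<longrightarrow> 3 * degree b' + D < n" "c' \<noteq> 0 \<longrightarrow> 3 * degree c' + 2 * D < n"
      using cs' neq(1)[of "degree a" "degree b'"] neq(2)[of "degree a" "degree c'"] by metis+
    show ?thesis unfolding weight_below_def
      by (rule exI[of _ "lead_coeff a / lead_coeff a'"], intro conjI top0 low) (use 1 c' in auto)
  next
    case 2
    hence c': "b' \<noteq> 0" "3 * degree b' + D = n" "a' \<noteq> 0 \<longrightarrow> 3 * degree a' < n" "c' \<noteq> 0 \<longrightarrow> 3 * degree c' + 2 * D < n"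
      using cs' neq(1)[of "degree a'" "degree b"] neq(3)[of "degree b" "degree c'"] by metis+
    show ?thesis unfolding weight_below_def
      by (rule exI[of _ "lead_coeff b / lead_coeff b'"], intro conjI low0 top low) (use 2 c' in auto)
  next
    case 3
    hence c': "c' \<noteq> 0" "3 * degree c' + 2 * D = n" "a' \<noteq> 0 \<longrightarrow> 3 * degree a' < n" "b' \<noteq> 0 \<longrightarrow> 3 * degree b' + D < n"
      using cs' neq(2)[of "degree a'" "degree c"] neq(3)[of "degree b'" "degree c"] by metis+
    show ?thesis unfolding weight_below_def
      by (rule exI[of _ "lead_coeff c / lead_coeff c'"], intro conjI low0 top low) (use 3 c' in auto)
  qed
  thus ?thesis using that unfolding D_def n_def by blast
qed

text \<open>
  Shifting the summation variable by 1 shows that the cardinality of a finite field vanishes in it.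
\<close>

lemma two_neq_0_if_card_power_3:
  assumes "CARD('k::{field,finite}) = 3 ^ n"
  shows "(2::'k) \<noteq> 0"
proof
  assume 2: "(2::'k) = 0"
  have "(\<Sum>x\<in>UNIV. x + (1::'k)) = (\<Sum>x\<in>UNIV. x)"
    by (rule sum.reindex_bij_witness[of _ "\<lambda>x. x - 1" "\<lambda>x. x + 1"]) auto
  hence "of_nat (CARD('k)) = (0::'k)" by (simp add: sum.distrib)
  hence "(3::'k) = 0" using assms by simp
  moreover have "(3::'k) = 2 + 1" by simp
  ultimately show False using 2 by simp
qed


section \<open>Linear combinations over the rational functions\<close>

definition lincomb :: "'k::field poly fract ^ 3 \<Rightarrow> 'k rf_closure ^ 3 \<Rightarrow> 'k rf_closure" where
  "lincomb v b = (\<Sum>j\<in>UNIV. of_rf (v $ j) * b $ j)"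

definition lincombs :: "'k::field poly fract ^ 3 ^ 3 \<Rightarrow> 'k rf_closure ^ 3 \<Rightarrow> 'k rf_closure ^ 3" where
  "lincombs M b = (\<chi> i. lincomb (M $ i) b)"

definition fract_vec :: "'k::field poly ^ 3 \<Rightarrow> 'k poly fract ^ 3" where
  "fract_vec p = (\<chi> j. to_fract (p $ j))"

definition fract_mat :: "'k::field poly ^ 3 ^ 3 \<Rightarrow> 'k poly fract ^ 3 ^ 3" where
  "fract_mat M = (\<chi> i. fract_vec (M $ i))"

definition independent_over_rf :: "'k::field rf_closure ^ 3 \<Rightarrow> bool" where
  "independent_over_rf b \<longleftrightarrow> (\<forall>v. lincomb v b = 0 \<longrightarrow> v = 0)"

lemma lincombs_nth [simp]: "lincombs M b $ i = lincomb (M $ i) b"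
  by (simp add: lincombs_def)

lemma fract_vec_nth [simp]: "fract_vec p $ i = to_fract (p $ i)"
  by (simp add: fract_vec_def)

lemma fract_mat_nth [simp]: "fract_mat M $ i = fract_vec (M $ i)"
  by (simp add: fract_mat_def)

lemma lincomb_0 [simp]: "lincomb 0 b = 0"
  by (simp add: lincomb_def)

lemma lincomb_add: "lincomb (v + w) b = lincomb v b + lincomb w b"
  by (simp add: lincomb_def sum_3 algebra_simps)

lemma lincomb_diff: "lincomb (v - w) b = lincomb v b - lincomb w b"
  by (simp add: lincomb_def sum_3 algebra_simps)

lemma lincomb_minus: "lincomb (- v) b = - lincomb v b"
  by (simp add: lincomb_def sum_3 algebra_simps)

lemma lincomb_scale: "lincomb (c *s v) b = of_rf c * lincomb v b"
  by (simp add: lincomb_def sum_3 algebra_simps)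

lemma lincomb_times_basis: "lincomb v (\<chi> i. z * b $ i) = z * lincomb v b"
  by (simp add: lincomb_def sum_3 algebra_simps)

lemma lincomb_lincombs: "lincomb v (lincombs M b) = lincomb (v v* M) b"
  by (simp add: lincomb_def lincombs_def vector_matrix_mult_def sum_3 algebra_simps)

lemma lincombs_lincombs: "lincombs N (lincombs M b) = lincombs (N ** M) b"
  by (simp add: vec_eq_iff lincomb_def matrix_matrix_mult_def sum_3 algebra_simps)

lemma lincombs_times_basis: "lincombs M (\<chi> i. z * b $ i) = (\<chi> i. z * lincombs M b $ i)"
  by (simp add: vec_eq_iff lincomb_times_basis)

lemma fract_vec_add: "fract_vec (p + q) = fract_vec p + fract_vec q"
  by (simp add: vec_eq_iff)

lemma fract_vec_diff: "fract_vec (p - q) = fract_vec p - fract_vec q"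
  by (simp add: vec_eq_iff)

lemma fract_vec_scale: "fract_vec (c *s p) = to_fract c *s fract_vec p"
  by (simp add: vec_eq_iff)

lemma fract_vec_0 [simp]: "fract_vec 0 = 0"
  by (simp add: vec_eq_iff)

lemma fract_vec_eq_0_iff [simp]: "fract_vec p = 0 \<longleftrightarrow> p = 0"
  by (simp add: vec_eq_iff)

lemma scaled_fract_vec_eq_0_iff:
  assumes "fract_vec p = to_fract n *s v" "n \<noteq> 0"
  shows "p = 0 \<longleftrightarrow> v = 0"
  using assms by (metis fract_vec_eq_0_iff to_fract_eq_0_iff vector_mul_eq_0)

lemma fract_vec_mult: "fract_vec (v v* M) = fract_vec v v* fract_mat M"
  by (simp add: vec_eq_iff vector_matrix_mult_def)

lemma fract_mat_mult: "fract_mat (M ** N) = fract_mat M ** fract_mat N"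
  by (simp add: vec_eq_iff matrix_matrix_mult_def)

lemma det_fract_mat: "det (fract_mat M) = to_fract (det M)"
  by (simp add: det_3)

lemma fract_mat_eq_iff: "fract_mat M = fract_mat N \<longleftrightarrow> M = N"
  by (simp add: vec_eq_iff)

lemma common_denominator:
  fixes v :: "'k::field poly fract ^ 3"
  obtains n p where "n \<noteq> 0" "fract_vec p = to_fract n *s v"
proof -
  have "\<exists>d m. d \<noteq> 0 \<and> to_fract d * r = to_fract m" for r :: "'k poly fract"
    by (cases r) (auto simp: Fract_conv_to_fract intro!: exI)
  then obtain d m where dm: "\<And>r. d r \<noteq> 0" "\<And>r::'k poly fract. to_fract (d r) * r = to_fract (m r)"
    by metis
  define n where "n = d (v$1) * d (v$2) * d (v$3)"
  define p :: "'k poly ^ 3" where "p = vector [m (v$1) * d (v$2) * d (v$3),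
     d (v$1) * m (v$2) * d (v$3), d (v$1) * d (v$2) * m (v$3)]"
  have "fract_vec p = to_fract n *s v"
    by (simp add: vec_eq_iff forall_3 p_def n_def dm(2)[symmetric])
  moreover have "n \<noteq> 0" using dm by (simp add: n_def)
  ultimately show ?thesis using that by blast
qed

lemma det_eq_0_iff_kernel:
  fixes M :: "'a::field ^ 'n ^ 'n"
  shows "det M = 0 \<longleftrightarrow> (\<exists>v. v \<noteq> 0 \<and> v v* M = 0)"
proof -
  have "det (transpose M) \<noteq> 0 \<longleftrightarrow> (\<forall>x. transpose M *v x = 0 \<longrightarrow> x = 0)"
    using invertible_det_nz[of "transpose M"] matrix_left_invertible_ker[of "transpose M"]
    by (simp add: invertible_left_inverse)
  thus ?thesis by (auto simp: det_transpose transpose_matrix_vector)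
qed

lemma independent_lincombs_iff:
  assumes "independent_over_rf b"
  shows "independent_over_rf (lincombs M b) \<longleftrightarrow> det M \<noteq> 0"
  using assms unfolding independent_over_rf_def det_eq_0_iff_kernel lincomb_lincombs
  by (metis lincomb_0)

lemma independent_lincombs_eq:
  assumes "independent_over_rf b" "lincombs M b = lincombs N b"
  shows "M = N"
proof -
  have "lincomb (M $ i - N $ i) b = 0" for i
    using assms(2) by (simp add: lincomb_diff vec_eq_iff)
  hence "M $ i - N $ i = 0" for i using assms(1) unfolding independent_over_rf_def by blast
  thus ?thesis by (simp add: vec_eq_iff)
qed

lemma independent_iff_poly:
  "independent_over_rf b \<longleftrightarrow> (\<forall>p. lincomb (fract_vec p) b = 0 \<longrightarrow> p = 0)"
proof
  assume *: "\<forall>p. lincomb (fract_vec p) b = 0 \<longrightarrow> p = 0"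
  show "independent_over_rf b"
    unfolding independent_over_rf_def
  proof (intro allI impI)
    fix v assume v: "lincomb v b = 0"
    obtain n p where np: "n \<noteq> 0" "fract_vec p = to_fract n *s v" by (rule common_denominator)
    have "p = 0" using * v np(2) by (simp add: lincomb_scale)
    thus "v = 0" using np by (simp add: vec_eq_iff)
  qed
qed (auto simp: independent_over_rf_def)

lemma is_pol_basis_iff:
  "is_pol_basis b S \<longleftrightarrow> S = range (\<lambda>p. lincomb (fract_vec p) b) \<and> independent_over_rf b"
  by (simp add: is_pol_basis_def independent_iff_poly lincomb_def)

lemma rf_degree_Fract:
  assumes "p \<noteq> 0" "q \<noteq> 0"
  shows "rf_degree (Fract p q) = int (degree p) - int (degree q)"
  unfolding rf_degree_def
proof (rule the_equality)
  show "\<exists>p' q'. p' \<noteq> 0 \<and> q' \<noteq> 0 \<and> Fract p q = Fract p' q' \<and>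
      int (degree p) - int (degree q) = int (degree p') - int (degree q')"
    using assms by blast
  fix d assume "\<exists>p' q'. p' \<noteq> 0 \<and> q' \<noteq> 0 \<and> Fract p q = Fract p' q' \<and> d = int (degree p') - int (degree q')"
  then obtain p' q' where pq: "p' \<noteq> 0" "q' \<noteq> 0" "Fract p q = Fract p' q'" 
    "d = int (degree p') - int (degree q')" by blast
  have "p * q' = p' * q" using pq assms by (simp add: eq_fract)
  hence "degree (p * q') = degree (p' * q)" by simp
  thus "d = int (degree p) - int (degree q)" using pq assms by (simp add: degree_mult_eq)
qed

lemma rf_degree_mult:
  assumes "r \<noteq> 0" "s \<noteq> 0"
  shows "rf_degree (r * s) = rf_degree r + rf_degree s"
proof -
  obtain a b c d where r: "r = Fract a b" "b \<noteq> 0" and s: "s = Fract c d" "d \<noteq> 0"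
    by (metis Fract_cases)
  hence "a \<noteq> 0" "c \<noteq> 0" using assms by (auto simp: fract_collapse)
  thus ?thesis using r s by (simp add: rf_degree_Fract degree_mult_eq)
qed

lemma rf_degree_to_fract: "p \<noteq> 0 \<Longrightarrow> rf_degree (to_fract p) = int (degree p)"
  using rf_degree_Fract[of p 1] by (simp add: to_fract_def)

section \<open>The cubic function field\<close>

text \<open>
  Total ramification at infinity is encoded by the two conditions on degrees. The tuple \<open>b\<close> is some
  basis of the maximal order, whose existence is part of having an index.
\<close>

locale ramified_cubic =
  fixes A B :: "'k::{field,finite} poly" and y :: "'k rf_closure" and b :: "'k rf_closure ^ 3"
  assumes root: "y ^ 3 - of_pol A * y + of_pol B = 0"
    and degB: "\<not> 3 dvd degree B" and degA: "3 * degree A < 2 * degree B"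
    and two: "(2::'k) \<noteq> 0"
    and basis: "is_pol_basis b (max_order y)"
begin

definition elt :: "'k poly fract ^ 3 \<Rightarrow> 'k rf_closure" where
  "elt v = lincomb v (power_basis y)"

definition mult_mat :: "'k poly fract ^ 3 \<Rightarrow> 'k poly fract ^ 3 ^ 3" where
  "mult_mat v = vector [
     vector [v$1, v$2, v$3],
     vector [- v$3 * to_fract B, v$1 + v$3 * to_fract A, v$2],
     vector [- v$2 * to_fract B, v$2 * to_fract A - v$3 * to_fract B, v$1 + v$3 * to_fract A]]"

lemma power_basis_nth: "power_basis y $ 1 = 1" "power_basis y $ 2 = y" "power_basis y $ 3 = y ^ 2"
  by (simp_all add: power_basis_def)

lemma elt_eq: "elt v = of_rf (v$1) + of_rf (v$2) * y + of_rf (v$3) * y ^ 2"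
  by (simp add: elt_def lincomb_def sum_3 power_basis_nth)

lemma elt_times_basis: "elt v * power_basis y $ i = elt (mult_mat v $ i)"
proof -
  have y3: "y ^ 3 = of_pol A * y - of_pol B" using root by (simp add: algebra_simps)
  have y3': "y * y ^ 2 = of_pol A * y - of_pol B" using y3 by (simp add: eval_nat_numeral mult.assoc)
  have y4: "y ^ 2 * y ^ 2 = of_pol A * y ^ 2 - of_pol B * y"
    using arg_cong[OF y3', of "\<lambda>t. y * t"] by (simp add: power2_eq_square algebra_simps)
  have "\<forall>i. elt v * power_basis y $ i = elt (mult_mat v $ i)"
    unfolding forall_3 elt_eq power_basis_nth mult_mat_def vector_3
  proof (intro conjI)
    let ?a = "of_rf (v$1)" and ?b = "of_rf (v$2)" and ?c = "of_rf (v$3)"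
    show "(?a + ?b * y + ?c * y\<^sup>2) * y = of_rf (- v $ 3 * to_fract B)
         + of_rf (v $ 1 + v $ 3 * to_fract A) * y + ?b * y\<^sup>2"
    proof -
      have "(?a + ?b * y + ?c * y\<^sup>2) * y = ?a * y + ?b * y^2 + ?c * (y * y\<^sup>2)"
        by (simp add: power2_eq_square algebra_simps)
      thus ?thesis unfolding y3' by (simp add: algebra_simps)
    qed
    show "(?a + ?b * y + ?c * y\<^sup>2) * y\<^sup>2 = of_rf (- v $ 2 * to_fract B)
         + of_rf (v $ 2 * to_fract A - v $ 3 * to_fract B) * y + of_rf (v $ 1 + v $ 3 * to_fract A) * y\<^sup>2"
    proof -
      have "(?a + ?b * y + ?c * y\<^sup>2) * y\<^sup>2 = ?a * y^2 + ?b * (y * y^2) + ?c * (y\<^sup>2 * y\<^sup>2)"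
        by (simp add: algebra_simps)
      thus ?thesis unfolding y3' y4 by (simp add: algebra_simps)
    qed
  qed simp
  thus ?thesis by blast
qed

lemma elt_times_power_basis: "(\<chi> i. elt v * power_basis y $ i) = lincombs (mult_mat v) (power_basis y)"
  using elt_times_basis[of v] by (simp add: vec_eq_iff elt_def)

lemma elt_times_elt: "elt v * elt w = elt (w v* mult_mat v)"
  using lincomb_times_basis[of w "elt v" "power_basis y"]
  unfolding elt_times_power_basis lincomb_lincombs by (simp add: elt_def)

lemma det_mult_mat_poly:
  "det (mult_mat (fract_vec p)) = to_fract (norm_form A B (p$1) (p$2) (p$3))"
  by (simp add: det_3 mult_mat_def norm_form_def algebra_simps eval_nat_numeral
       flip: to_fract_add to_fract_mult to_fract_diff to_fract_uminus)

lemma mult_mat_scale: "det (mult_mat (c *s v)) = c ^ 3 * det (mult_mat v)"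
  by (simp add: det_3 mult_mat_def algebra_simps eval_nat_numeral)

lemma norm_form_vec:
  fixes p :: "'k poly ^ 3"
  assumes "p \<noteq> 0"
  shows "norm_form A B (p$1) (p$2) (p$3) \<noteq> 0"
    and "degree (norm_form A B (p$1) (p$2) (p$3)) < n \<longleftrightarrow> weight_below (degree B) n (p$1) (p$2) (p$3)"
proof -
  have "p$1 \<noteq> 0 \<or> p$2 \<noteq> 0 \<or> p$3 \<noteq> 0" using assms by (auto simp: vec_eq_iff forall_3)
  from norm_form_degree[OF degB degA this] show "norm_form A B (p$1) (p$2) (p$3) \<noteq> 0"
    and "degree (norm_form A B (p$1) (p$2) (p$3)) < n \<longleftrightarrow> weight_below (degree B) n (p$1) (p$2) (p$3)"
    by auto
qed

lemma det_mult_mat_nz: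
  assumes "v \<noteq> 0"
  shows "det (mult_mat v) \<noteq> 0"
proof -
  obtain n p where np: "n \<noteq> 0" "fract_vec p = to_fract n *s v" by (rule common_denominator)
  have "p \<noteq> 0" using scaled_fract_vec_eq_0_iff[OF np(2,1)] assms by simp
  hence "det (mult_mat (fract_vec p)) \<noteq> 0" by (simp add: det_mult_mat_poly norm_form_vec)
  thus ?thesis by (simp add: np mult_mat_scale)
qed

text \<open>
  A relation between \<open>1, y, y\<^sup>2\<close> would put this nonzero tuple into the kernel of a multiplication
  matrix, whose determinant is a nonzero value of the norm form.
\<close>

lemma elt_eq_0_iff [simp]: "elt v = 0 \<longleftrightarrow> v = 0"
proof
  assume e: "elt v = 0"
  show "v = 0"
  proof (rule ccontr)
    assume v: "v \<noteq> 0"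
    (* transposed, since kernels are taken with respect to row vectors *)
    define N where "N = transpose (map_matrix of_rf (mult_mat v))"
    have "power_basis y v* N = 0"
      using elt_times_basis[of v] e
      by (simp add: vec_eq_iff vector_matrix_mult_def N_def transpose_def elt_def lincomb_def mult.commute)
    moreover have "power_basis y \<noteq> 0" using power_basis_nth by (metis zero_index zero_neq_one)
    ultimately have "det N = 0" unfolding det_eq_0_iff_kernel by blast
    moreover have "det N = of_rf (det (mult_mat v))"
      by (simp add: N_def det_transpose) (simp add: det_3)
    ultimately show False using det_mult_mat_nz[OF v] by simp
  qed
qed (simp add: elt_def)

lemma independent_power_basis: "independent_over_rf (power_basis y)"
  using elt_eq_0_iff by (simp add: independent_over_rf_def elt_def)

lemma elt_of_rf: "elt (vector [r, 0, 0]) = of_rf r"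
  by (simp add: elt_eq)

lemma elt_inverse: "\<exists>w. inverse (elt v) = elt w"
proof (cases "v = 0")
  case False
  hence "invertible (mult_mat v)" using det_mult_mat_nz by (simp add: invertible_det_nz)
  then obtain M where M: "M ** mult_mat v = mat 1" unfolding invertible_def by blast
  have "elt v * elt (M $ 1) = elt ((M ** mult_mat v) $ 1)"
    unfolding elt_times_elt 
    by (rule arg_cong[of _ _ elt]) 
      (simp add: vec_eq_iff vector_matrix_mult_def matrix_matrix_mult_def mult.commute)
  also have "\<dots> = 1" unfolding M by (simp add: elt_eq mat_def)
  finally show ?thesis by (metis inverse_unique)
qed (metis elt_eq_0_iff inverse_zero)

lemma function_field_eq: "function_field y = range elt"
proof (rule subset_antisym; rule subsetI)
  fix z assume "z \<in> function_field y"
  thus "z \<in> range elt"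
  proof induction
    case (base r) show ?case using elt_of_rf by (metis rangeI)
  next
    case gen
    have "y = elt (vector [0, 1, 0])" by (simp add: elt_eq)
    thus ?case by blast
  next
    case (add u v) thus ?case by (auto simp: elt_def simp flip: lincomb_add)
  next
    case (uminus u) thus ?case by (auto simp: elt_def simp flip: lincomb_minus)
  next
    case (mult u v) thus ?case by (auto simp: elt_times_elt)
  next
    case (inverse u) thus ?case using elt_inverse by auto
  qed
next
  fix z assume "z \<in> range elt"
  thus "z \<in> function_field y"
    by (auto simp: elt_eq power2_eq_square intro!: function_field.intros)
qed

lemma function_field_elt: "elt v \<in> function_field y"
  by (simp add: function_field_eq)

lemma function_field_0: "0 \<in> function_field y" and function_field_1: "1 \<in> function_field y"
  using function_field.base[of 0 y] function_field.base[of 1 y] by simp_all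

lemma function_field_divide:
  "u \<in> function_field y \<Longrightarrow> v \<in> function_field y \<Longrightarrow> u / v \<in> function_field y"
  by (simp add: divide_inverse function_field.mult function_field.inverse)

lemma mult_matrix_unique:
  assumes "(\<chi> i. z * power_basis y $ i) = lincombs M (power_basis y)"
  shows "mult_matrix y z = M"
proof -
  have *: "(\<forall>i. z * power_basis y $ i = (\<Sum>j\<in>UNIV. of_rf (M $ i $ j) * power_basis y $ j)) \<longleftrightarrow>
      (\<chi> i. z * power_basis y $ i) = lincombs M (power_basis y)" for M
    by (simp add: vec_eq_iff lincomb_def)
  show ?thesis unfolding mult_matrix_def *
    using assms independent_lincombs_eq[OF independent_power_basis] by (intro the_equality) auto
qed

lemma mult_matrix_elt: "mult_matrix y (elt v) = mult_mat v"
  by (rule mult_matrix_unique) (rule elt_times_power_basis)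

lemma mult_matrix_basis:
  assumes "z \<in> function_field y"
  shows "(\<chi> i. z * power_basis y $ i) = lincombs (mult_matrix y z) (power_basis y)"
  using assms elt_times_power_basis mult_matrix_elt by (auto simp: function_field_eq)

lemma field_norm_mult:
  assumes "u \<in> function_field y" "z \<in> function_field y"
  shows "field_norm y (u * z) = field_norm y u * field_norm y z"
proof -
  have "(\<chi> i. u * z * power_basis y $ i) = (\<chi> i. u * (\<chi> i. z * power_basis y $ i) $ i)"
    by (simp add: mult.assoc)
  also have "\<dots> = lincombs (mult_matrix y z) (\<chi> i. u * power_basis y $ i)"
    unfolding mult_matrix_basis[OF assms(2)] lincombs_times_basis ..
  also have "\<dots> = lincombs (mult_matrix y z ** mult_matrix y u) (power_basis y)"
    unfolding mult_matrix_basis[OF assms(1)] lincombs_lincombs ..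
  finally have "mult_matrix y (u * z) = mult_matrix y z ** mult_matrix y u"
    by (rule mult_matrix_unique)
  thus ?thesis by (simp add: field_norm_def det_mul)
qed

lemma field_norm_nz:
  assumes "z \<in> function_field y" "z \<noteq> 0"
  shows "field_norm y z \<noteq> 0"
  using assms det_mult_mat_nz by (auto simp: field_norm_def function_field_eq mult_matrix_elt)

text \<open>
  Minus the valuation at the unique infinite place.
\<close>

definition norm_degree :: "'k rf_closure \<Rightarrow> int" where
  "norm_degree z = rf_degree (field_norm y z)"

lemma norm_degree_mult:
  assumes "u \<in> function_field y" "z \<in> function_field y" "u \<noteq> 0" "z \<noteq> 0"
  shows "norm_degree (u * z) = norm_degree u + norm_degree z"
  using assms by (simp add: norm_degree_def field_norm_mult field_norm_nz rf_degree_mult)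

lemma norm_degree_elt:
  assumes "fract_vec p = to_fract n *s v" "n \<noteq> 0" "v \<noteq> 0"
  shows "int (degree (norm_form A B (p$1) (p$2) (p$3))) = norm_degree (elt v) + 3 * int (degree n)"
proof -
  have p: "p \<noteq> 0" using scaled_fract_vec_eq_0_iff[OF assms(1,2)] assms by simp
  have "to_fract (norm_form A B (p$1) (p$2) (p$3)) = to_fract (n ^ 3) * field_norm y (elt v)"
    using assms(1) det_mult_mat_poly[of p]
    by (simp add: mult_mat_scale field_norm_def mult_matrix_elt eval_nat_numeral)
  hence "rf_degree (to_fract (norm_form A B (p$1) (p$2) (p$3))) 
      = rf_degree (to_fract (n ^ 3)) + norm_degree (elt v)"
    using assms by (simp add: norm_degree_def rf_degree_mult field_norm_nz function_field_elt)
  thus ?thesis using assms(2) p by (simp add: rf_degree_to_fract norm_form_vec(1) degree_power_eq)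
qed

text \<open>
  After clearing denominators both elements have polynomial coordinates, and
  \<open>norm_form_cancel\<close> applies to these.
\<close>

lemma norm_degree_cancel:
  assumes "u \<in> function_field y" "z \<in> function_field y" "u \<noteq> 0" "z \<noteq> 0"
    and "norm_degree u = norm_degree z"
  obtains k where "u - of_pol [:k:] * z = 0 \<or> norm_degree (u - of_pol [:k:] * z) < norm_degree u"
proof -
  obtain v w where vw: "u = elt v" "z = elt w" using assms by (auto simp: function_field_eq)
  have nz: "v \<noteq> 0" "w \<noteq> 0" using assms vw by auto
  obtain n1 p1 where 1: "n1 \<noteq> 0" "fract_vec p1 = to_fract n1 *s v" by (rule common_denominator)
  obtain n2 p2 where 2: "n2 \<noteq> 0" "fract_vec p2 = to_fract n2 *s w" by (rule common_denominator)
  (* a common denominator is used so that both norm degrees are shifted by the same amount *)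
  define n where "n = n1 * n2"
  define p where "p = n2 *s p1"
  define q where "q = n1 *s p2"
  have n: "n \<noteq> 0" using 1 2 n_def by simp
  have p: "fract_vec p = to_fract n *s v" unfolding p_def fract_vec_scale 1(2) n_def 
    by (simp add: vec_eq_iff)
  have q: "fract_vec q = to_fract n *s w" unfolding q_def fract_vec_scale 2(2) n_def 
    by (simp add: vec_eq_iff)
  have pq: "p \<noteq> 0" "q \<noteq> 0"
    using scaled_fract_vec_eq_0_iff[OF p n] scaled_fract_vec_eq_0_iff[OF q n] nz by simp_all
  have "degree (norm_form A B (p$1) (p$2) (p$3)) = degree (norm_form A B (q$1) (q$2) (q$3))"
    using norm_degree_elt[OF p n nz(1)] norm_degree_elt[OF q n nz(2)] assms(5) vw by simp
  moreover have "p$1 \<noteq> 0 \<or> p$2 \<noteq> 0 \<or> p$3 \<noteq> 0" "q$1 \<noteq> 0 \<or> q$2 \<noteq> 0 \<or> q$3 \<noteq> 0"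
    using pq by (auto simp: vec_eq_iff forall_3)
  ultimately obtain k where k: "weight_below (degree B) (degree (norm_form A B (p$1) (p$2) (p$3)))
      (p$1 - smult k (q$1)) (p$2 - smult k (q$2)) (p$3 - smult k (q$3))"
    using norm_form_cancel[OF degB degA] by blast
  define x where "x = v - to_fract [:k:] *s w"
  define r where "r = p - [:k:] *s q"
  have ux: "u - of_pol [:k:] * z = elt x"
    by (simp add: vw x_def elt_def lincomb_diff lincomb_scale)
  have r: "fract_vec r = to_fract n *s x"
    unfolding r_def x_def fract_vec_diff fract_vec_scale p q by (simp add: vec_eq_iff algebra_simps)
  have "elt x = 0 \<or> norm_degree (elt x) < norm_degree u"
  proof (cases "x = 0")
    case False
    have "r \<noteq> 0" using scaled_fract_vec_eq_0_iff[OF r n] False by simp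
    hence "degree (norm_form A B (r$1) (r$2) (r$3)) < degree (norm_form A B (p$1) (p$2) (p$3))"
      unfolding norm_form_vec(2)[OF \<open>r \<noteq> 0\<close>] using k by (simp add: r_def)
    thus ?thesis using norm_degree_elt[OF p n nz(1)] norm_degree_elt[OF r n False] vw by simp
  qed simp
  thus ?thesis using that ux by metis
qed

end


section \<open>Integral elements and polynomial lattices\<close>

definition eval_pol :: "'k::field poly poly \<Rightarrow> 'k rf_closure \<Rightarrow> 'k rf_closure" where
  "eval_pol p z = poly (map_poly of_pol p) z"

lemma eval_pol_0 [simp]: "eval_pol 0 z = 0"
  by (simp add: eval_pol_def)

lemma eval_pol_pCons [simp]: "eval_pol (pCons a p) z = of_pol a + z * eval_pol p z"
  by (simp add: eval_pol_def map_poly_pCons)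

lemma eval_pol_add: "eval_pol (p + q) z = eval_pol p z + eval_pol q z"
  by (induction p q rule: poly_induct2) (simp_all add: algebra_simps)

lemma eval_pol_smult: "eval_pol (smult a p) z = of_pol a * eval_pol p z"
  by (induction p) (simp_all add: algebra_simps)

lemma eval_pol_minus: "eval_pol (- p) z = - eval_pol p z"
  by (induction p) simp_all

lemma eval_pol_mult: "eval_pol (p * q) z = eval_pol p z * eval_pol q z"
  by (induction p) (simp_all add: eval_pol_add eval_pol_smult algebra_simps)

lemma eval_pol_pcompose: "eval_pol (pcompose p q) z = eval_pol p (eval_pol q z)"
  by (induction p) (simp_all add: pcompose_pCons eval_pol_add eval_pol_mult)

lemma even_odd_parts:
  fixes p :: "'a::comm_ring_1 poly"
  shows "\<exists>e f. p = pcompose e [:0, 0, 1:] + [:0, 1:] * pcompose f [:0, 0, 1:]"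
proof (induction p)
  case (pCons a p)
  then obtain e f where p: "p = pcompose e [:0, 0, 1:] + [:0, 1:] * pcompose f [:0, 0, 1:]"
    by blast
  have "pCons a p = [:a:] + [:0, 1:] * p" by simp
  also have "\<dots> = pcompose (pCons a f) [:0, 0, 1:] + [:0, 1:] * pcompose e [:0, 0, 1:]"
    unfolding p pcompose_pCons by (simp add: algebra_simps)
  finally show ?case by blast
qed (intro exI[of _ 0], simp)

text \<open>
  If \<open>p = e(T\<^sup>2) + T f(T\<^sup>2)\<close> vanishes at \<open>z\<close>, then \<open>q = e\<^sup>2 - T f\<^sup>2\<close> vanishes at \<open>z\<^sup>2\<close>, because
  \<open>q(T\<^sup>2) = p(T) p(-T)\<close>. The same identity shows that \<open>q\<close> is monic up to sign.
\<close>

lemma integral_square: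
  assumes p: "lead_coeff p = 1" "eval_pol p z = 0"
  obtains q where "lead_coeff q = 1" "eval_pol q (z\<^sup>2) = 0"
proof -
  let ?s = "[:0, 0, 1:] :: 'a poly poly" and ?x = "[:0, 1:] :: 'a poly poly"
  obtain e f where ef: "p = pcompose e ?s + ?x * pcompose f ?s"
    using even_odd_parts by blast
  define q where "q = e\<^sup>2 - ?x * f\<^sup>2"
  have e: "eval_pol p z = eval_pol e (z\<^sup>2) + z * eval_pol f (z\<^sup>2)"
    unfolding ef by (simp add: eval_pol_add eval_pol_mult eval_pol_pcompose power2_eq_square)
  have "eval_pol q (z\<^sup>2) = (eval_pol e (z\<^sup>2))\<^sup>2 - z\<^sup>2 * (eval_pol f (z\<^sup>2))\<^sup>2"
    unfolding q_def diff_conv_add_uminus eval_pol_add eval_pol_minus power2_eq_square eval_pol_mult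
    by simp
  also have "\<dots> = eval_pol p z * (eval_pol e (z\<^sup>2) - z * eval_pol f (z\<^sup>2))"
    unfolding e by (simp add: power2_eq_square algebra_simps)
  finally have q0: "eval_pol q (z\<^sup>2) = 0" using p by simp
  have ss: "pcompose ?s [:0, - 1:] = ?s" "pcompose ?x [:0, - 1:] = [:0, - 1:]" "pcompose ?x ?s = ?s"
    by (simp_all add: pcompose_pCons)
  have pm: "pcompose p [:0, - 1:] = pcompose e ?s - ?x * pcompose f ?s"
    unfolding ef pcompose_add pcompose_mult by (simp flip: pcompose_assoc add: ss)
  have sq: "(u + x * v) * (u - x * v) = u * u - (x * x) * (v * v)" for u v x :: "'a poly poly"
    by (simp add: algebra_simps)
  have "p * pcompose p [:0, - 1:] =
      (pcompose e ?s + ?x * pcompose f ?s) * (pcompose e ?s - ?x * pcompose f ?s)"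
    unfolding pm ef[symmetric] ..
  also have "\<dots> = pcompose e ?s * pcompose e ?s - (?x * ?x) * (pcompose f ?s * pcompose f ?s)"
    by (rule sq)
  also have "\<dots> = pcompose q ?s"
    unfolding q_def pcompose_diff pcompose_mult power2_eq_square ss by simp
  finally have pp: "p * pcompose p [:0, - 1:] = pcompose q ?s" .
  have "lead_coeff (pcompose q ?s) = lead_coeff p * lead_coeff (pcompose p [:0, - 1:])"
    unfolding pp[symmetric] by (rule lead_coeff_mult)
  hence lc: "lead_coeff q = (- 1) ^ degree p"
    using p by (simp add: lead_coeff_comp)
  define q' where "q' = smult (lead_coeff q) q"
  have "lead_coeff q' = 1" unfolding q'_def lc
    by (simp add: lead_coeff_smult lc flip: power_add mult_2)
  moreover have "eval_pol q' (z\<^sup>2) = 0" by (simp add: q'_def eval_pol_smult q0)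
  ultimately show ?thesis using that by blast
qed

lemma poly_ideal_generator:
  fixes T :: "'a::field poly set"
  assumes add: "\<And>p q. p \<in> T \<Longrightarrow> q \<in> T \<Longrightarrow> p + q \<in> T"
    and mult: "\<And>c p. p \<in> T \<Longrightarrow> c * p \<in> T" and ex: "\<exists>p\<in>T. p \<noteq> 0"
  obtains g where "g \<in> T" "g \<noteq> 0" "\<And>p. p \<in> T \<Longrightarrow> g dvd p"
proof -
  obtain g where g: "g \<in> T" "g \<noteq> 0" and min: "\<And>p. p \<in> T \<Longrightarrow> p \<noteq> 0 \<Longrightarrow> degree g \<le> degree p"
    using ex_has_least_nat[of "\<lambda>p. p \<in> T \<and> p \<noteq> 0" _ degree] ex by blast
  have "g dvd p" if "p \<in> T" for p
  proof -
    have "p mod g = p + (- (p div g)) * g"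
      using div_mult_mod_eq[of p g] by (simp add: algebra_simps)
    hence "p mod g \<in> T" using add mult that g by metis
    hence "p mod g = 0" using min degree_mod_less[OF g(2), of p] by force
    thus ?thesis by blast
  qed
  thus ?thesis using that g by blast
qed

lemma monic_dvd_antisym:
  fixes p q :: "'a::field poly"
  assumes "lead_coeff p = 1" "lead_coeff q = 1" "p dvd q" "q dvd p"
  shows "p = q"
proof -
  have nz: "p \<noteq> 0" "q \<noteq> 0" using assms(1,2) by auto
  obtain r where r: "q = p * r" using assms(3) by (elim dvdE)
  have "degree q \<le> degree p" using assms(4) nz by (intro dvd_imp_degree_le)
  hence "degree r = 0" using nz unfolding r by (simp add: degree_mult_eq)
  then obtain c where c: "r = [:c:]" by (rule degree_eq_zeroE)
  have "c = 1" using assms(1,2) unfolding r c by (cases "c = 0") simp_all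
  thus ?thesis by (simp add: r c)
qed

text \<open>
  Hermite normal form: the \<open>j\<close>-th basis vector generates, in its \<open>j\<close>-th component, the ideal of all
  \<open>j\<close>-th components of vectors whose earlier components vanish. The submodule has full rank, so none
  of these ideals is zero.
\<close>

lemma triangular_basis:
  fixes S :: "('a::field poly ^ 3) set"
  assumes add: "\<And>p q. p \<in> S \<Longrightarrow> q \<in> S \<Longrightarrow> p + q \<in> S"
    and scale: "\<And>c p. p \<in> S \<Longrightarrow> c *s p \<in> S"
    and full: "n \<noteq> 0" "\<And>p. n *s p \<in> S"
  obtains M where "det M \<noteq> 0" "S = range (\<lambda>c. c v* M)"
proof -
  define T1 where "T1 = (\<lambda>v. v$1) ` S"
  define T2 where "T2 = (\<lambda>v. v$2) ` {v\<in>S. v$1 = 0}"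
  define T3 where "T3 = (\<lambda>v. v$3) ` {v\<in>S. v$1 = 0 \<and> v$2 = 0}"
  have "\<exists>g. g \<in> T1 \<and> g \<noteq> 0 \<and> (\<forall>p\<in>T1. g dvd p)"
  proof (rule poly_ideal_generator[of T1])
    show "\<exists>p\<in>T1. p \<noteq> 0" unfolding T1_def
      by (rule bexI[OF _ imageI[OF full(2)[of "vector [1,0,0]"]]]) (use full(1) in simp)
    show "p + q \<in> T1" if "p \<in> T1" "q \<in> T1" for p q
      using that add unfolding T1_def by (force simp flip: vector_add_component)
    show "c * p \<in> T1" if "p \<in> T1" for p c
      using that scale unfolding T1_def by (force simp flip: vector_smult_component)
  qed blast
  then obtain m1 where m1: "m1 \<in> S" "m1$1 \<noteq> 0" "\<And>v. v \<in> S \<Longrightarrow> m1$1 dvd v$1"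
    unfolding T1_def by auto
  have "\<exists>g. g \<in> T2 \<and> g \<noteq> 0 \<and> (\<forall>p\<in>T2. g dvd p)"
  proof (rule poly_ideal_generator[of T2])
    show "\<exists>p\<in>T2. p \<noteq> 0" unfolding T2_def
      by (rule bexI[OF _ imageI, of _ _ "n *s vector [0,1,0]"]) (use full in simp_all)
    show "p + q \<in> T2" if "p \<in> T2" "q \<in> T2" for p q
    proof -
      from that obtain v w where "v \<in> S" "v$1 = 0" "p = v$2" "w \<in> S" "w$1 = 0" "q = w$2"
        unfolding T2_def by auto
      thus ?thesis unfolding T2_def using add[of v w] by (intro image_eqI[of _ _ "v + w"]) auto
    qed
    show "c * p \<in> T2" if "p \<in> T2" for p c
    proof -
      from that obtain v where "v \<in> S" "v$1 = 0" "p = v$2"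
        unfolding T2_def by auto
      thus ?thesis unfolding T2_def using scale[of v c] by (intro image_eqI[of _ _ "c *s v"]) auto
    qed
  qed blast
  then obtain m2 where m2: "m2 \<in> S" "m2$1 = 0" "m2$2 \<noteq> 0"
      "\<And>v. v \<in> S \<Longrightarrow> v$1 = 0 \<Longrightarrow> m2$2 dvd v$2"
    unfolding T2_def by auto
  have "\<exists>g. g \<in> T3 \<and> g \<noteq> 0 \<and> (\<forall>p\<in>T3. g dvd p)"
  proof (rule poly_ideal_generator[of T3])
    show "\<exists>p\<in>T3. p \<noteq> 0" unfolding T3_def
      by (rule bexI[OF _ imageI, of _ _ "n *s vector [0,0,1]"]) (use full in simp_all)
    show "p + q \<in> T3" if "p \<in> T3" "q \<in> T3" for p q
    proof -
      from that obtain v w where "v \<in> S" "v$1 = 0" "v$2 = 0" "p = v$3" 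
          "w \<in> S" "w$1 = 0" "w$2 = 0" "q = w$3"
        unfolding T3_def by auto
      thus ?thesis unfolding T3_def using add[of v w] by (intro image_eqI[of _ _ "v + w"]) auto
    qed
    show "c * p \<in> T3" if "p \<in> T3" for p c
    proof -
      from that obtain v where "v \<in> S" "v$1 = 0" "v$2 = 0" "p = v$3"
        unfolding T3_def by auto
      thus ?thesis unfolding T3_def using scale[of v c] by (intro image_eqI[of _ _ "c *s v"]) auto
    qed
  qed blast
  then obtain m3 where m3: "m3 \<in> S" "m3$1 = 0" "m3$2 = 0" "m3$3 \<noteq> 0"
      "\<And>v. v \<in> S \<Longrightarrow> v$1 = 0 \<Longrightarrow> v$2 = 0 \<Longrightarrow> m3$3 dvd v$3"
    unfolding T3_def by auto
  define M :: "'a poly ^ 3 ^ 3" where "M = vector [m1, m2, m3]"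
  have vM: "c v* M = c$1 *s m1 + c$2 *s m2 + c$3 *s m3" for c
    by (simp add: vec_eq_iff vector_matrix_mult_def sum_3 M_def mult.commute)
  have sub: "v - c *s w \<in> S" if "v \<in> S" "w \<in> S" for v w c
    using add[OF that(1) scale[OF that(2), of "- c"]] by (simp add: vector_smult_lneg)
  have "det M \<noteq> 0" using m1 m2 m3 by (simp add: det_3 M_def)
  moreover have "S = range (\<lambda>c. c v* M)"
  proof (rule subset_antisym; rule subsetI)
    fix v assume v: "v \<in> S"
    obtain q1 where q1: "v$1 = m1$1 * q1" using m1(3)[OF v] by (elim dvdE)
    define v' where "v' = v - q1 *s m1"
    have v': "v' \<in> S" "v'$1 = 0" using sub[OF v m1(1)] q1 by (simp_all add: v'_def)
    obtain q2 where q2: "v'$2 = m2$2 * q2" using m2(4)[OF v'] by (elim dvdE)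
    define v'' where "v'' = v' - q2 *s m2"
    have v'': "v'' \<in> S" "v''$1 = 0" "v''$2 = 0" 
      using sub[OF v'(1) m2(1)] q2 v' m2 by (simp_all add: v''_def)
    obtain q3 where q3: "v''$3 = m3$3 * q3" using m3(5)[OF v''] by (elim dvdE)
    have "v'' = q3 *s m3" using v'' q3 m3 by (simp add: vec_eq_iff forall_3)
    hence "v = vector [q1, q2, q3] v* M" unfolding vM v''_def v'_def
      by (simp add: algebra_simps)
    thus "v \<in> range (\<lambda>c. c v* M)" by blast
  next
    fix v assume "v \<in> range (\<lambda>c. c v* M)"
    thus "v \<in> S" using m1 m2 m3 by (auto simp: vM intro!: add scale)
  qed
  ultimately show ?thesis using that by blast
qed

lemma finite_polys_degree_le:
  "finite {p :: 'a::{zero,finite} poly. degree p \<le> d}"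
proof (rule finite_surj[of "{xs :: 'a list. set xs \<subseteq> UNIV \<and> length xs \<le> Suc d}" _ Poly])
  show "finite {xs :: 'a list. set xs \<subseteq> UNIV \<and> length xs \<le> Suc d}"
    by (rule finite_lists_length_le) simp
  show "{p :: 'a poly. degree p \<le> d} \<subseteq> Poly ` {xs. set xs \<subseteq> UNIV \<and> length xs \<le> Suc d}"
  proof
    fix p :: "'a poly" assume "p \<in> {p. degree p \<le> d}"
    hence "length (coeffs p) \<le> Suc d" by (cases "p = 0") (auto simp: length_coeffs)
    thus "p \<in> Poly ` {xs. set xs \<subseteq> UNIV \<and> length xs \<le> Suc d}"
      by (intro image_eqI[of _ _ "coeffs p"]) auto
  qed
qed


lemma finite_vec_3:
  assumes "finite (T :: 'a set)"
  shows "finite {v :: 'a ^ 3. \<forall>j. v $ j \<in> T}"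
proof (rule finite_surj)
  show "finite (T \<times> T \<times> T)" using assms by simp
  let ?f = "\<lambda>(a, b, c). (\<chi> j. if j = 1 then a else if j = 2 then b else c) :: 'a ^ 3"
  show "{v :: 'a ^ 3. \<forall>j. v $ j \<in> T} \<subseteq> ?f ` (T \<times> T \<times> T)"
  proof
    fix v :: "'a ^ 3" assume v: "v \<in> {v. \<forall>j. v $ j \<in> T}"
    have "v $ j = ?f (v$1, v$2, v$3) $ j" for j using exhaust_3[of j] by auto
    hence "v = ?f (v$1, v$2, v$3)" unfolding vec_eq_iff by blast
    moreover have "(v$1, v$2, v$3) \<in> T \<times> T \<times> T" using v by simp
    ultimately show "v \<in> ?f ` (T \<times> T \<times> T)" by (rule image_eqI)
  qed
qed


section \<open>The maximal order\<close>

context ramified_cubic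
begin

lemma max_order_iff: "z \<in> max_order y \<longleftrightarrow>
    z \<in> function_field y \<and> (\<exists>p. lead_coeff p = 1 \<and> eval_pol p z = 0)"
  by (simp add: max_order_def eval_pol_def)

lemma max_order_eq: "max_order y = range (\<lambda>p. lincomb (fract_vec p) b)"
  and independent_basis: "independent_over_rf b"
  using basis by (simp_all add: is_pol_basis_iff)

lemma max_order_subset: "z \<in> max_order y \<Longrightarrow> z \<in> function_field y"
  by (simp add: max_order_iff)

lemma max_order_of_pol: "of_pol c \<in> max_order y"
  unfolding max_order_iff
  by (intro conjI function_field.base exI[of _ "[:- c, 1:]"]) simp_all

lemma max_order_0: "0 \<in> max_order y" and max_order_1: "1 \<in> max_order y"
  using max_order_of_pol[of 0] max_order_of_pol[of 1] by simp_all

lemma max_order_add: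
  assumes "u \<in> max_order y" "v \<in> max_order y"
  shows "u + v \<in> max_order y"
proof -
  obtain p q where "u = lincomb (fract_vec p) b" "v = lincomb (fract_vec q) b"
    using assms unfolding max_order_eq by blast
  hence "u + v = lincomb (fract_vec (p + q)) b" by (simp add: fract_vec_add lincomb_add)
  thus ?thesis unfolding max_order_eq by blast
qed

lemma max_order_scale:
  assumes "u \<in> max_order y"
  shows "of_pol c * u \<in> max_order y"
proof -
  obtain p where "u = lincomb (fract_vec p) b"
    using assms unfolding max_order_eq by blast
  hence "of_pol c * u = lincomb (fract_vec (c *s p)) b" by (simp add: fract_vec_scale lincomb_scale)
  thus ?thesis unfolding max_order_eq by blast
qed

lemma max_order_minus: "u \<in> max_order y \<Longrightarrow> - u \<in> max_order y"
  using max_order_scale[of u "- 1"] by simp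

lemma max_order_diff: "u \<in> max_order y \<Longrightarrow> v \<in> max_order y \<Longrightarrow> u - v \<in> max_order y"
  using max_order_add[of u "- v"] max_order_minus[of v] by simp

lemma max_order_square:
  assumes "u \<in> max_order y"
  shows "u\<^sup>2 \<in> max_order y"
proof -
  obtain p where "lead_coeff p = 1" "eval_pol p u = 0"
    using assms by (auto simp: max_order_iff)
  then obtain q where "lead_coeff q = 1" "eval_pol q (u\<^sup>2) = 0" by (rule integral_square)
  moreover have "u\<^sup>2 \<in> function_field y"
    using assms by (simp add: power2_eq_square max_order_iff function_field.mult)
  ultimately show ?thesis unfolding max_order_iff by blast
qed

text \<open>
  Sums of integral elements are integral since the maximal order is a lattice; products reduce to
  squares by \<open>2uv = (u + v)\<^sup>2 - u\<^sup>2 - v\<^sup>2\<close>, as 2 is invertible.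
\<close>

lemma max_order_mult:
  assumes "u \<in> max_order y" "v \<in> max_order y"
  shows "u * v \<in> max_order y"
proof -
  have "[:1/2:] * [:2:] = (1 :: 'k poly)" 
    using two by (simp add: one_pCons)
  hence "of_pol ([:1/2:] * [:2:]) = (1 :: 'k rf_closure)" by (simp only: to_fract_1 to_ac_1)
  moreover have "of_pol [:2:] = (2 :: 'k rf_closure)"
  proof -
    have two_eq: "[:2:] = (1 + 1 :: 'k poly)" by (simp add: one_pCons)
    have "of_pol (1 + 1) = of_pol (1 :: 'k poly) + of_pol 1" by (simp only: to_fract_add to_ac_add)
    thus ?thesis unfolding two_eq by simp
  qed
  ultimately have half: "of_pol [:1/2:] * 2 = (1 :: 'k rf_closure)"
    by (simp only: to_fract_mult to_ac_mult)
  have "(u + v)\<^sup>2 - u\<^sup>2 - v\<^sup>2 \<in> max_order y"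
    using assms by (intro max_order_diff max_order_square max_order_add)
  moreover have "(u + v)\<^sup>2 - u\<^sup>2 - v\<^sup>2 = 2 * (u * v)" by (simp add: power2_eq_square algebra_simps)
  ultimately have "of_pol [:1/2:] * (2 * (u * v)) \<in> max_order y"
    using max_order_scale by metis
  moreover have "of_pol [:1/2:] * (2 * (u * v)) = u * v"
    unfolding mult.assoc[symmetric] half by simp
  ultimately show ?thesis by (simp only:)
qed

lemma max_order_power: "u \<in> max_order y \<Longrightarrow> u ^ n \<in> max_order y"
  by (induction n) (simp_all add: max_order_1 max_order_mult)

lemma max_order_eval_pol: "u \<in> max_order y \<Longrightarrow> eval_pol p u \<in> max_order y"
  by (induction p) (simp_all add: max_order_0 max_order_add max_order_of_pol max_order_mult)

text \<open>
  Solve an integral equation of \<open>u\<close> for its lowest nonzero coefficient.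
\<close>

lemma multiple_in_base:
  assumes "u \<in> max_order y" "u \<noteq> 0"
  obtains n v where "n \<noteq> 0" "v \<in> max_order y" "of_pol n = u * v"
proof -
  have *: "\<exists>n v. n \<noteq> 0 \<and> v \<in> max_order y \<and> of_pol n = u * v" if "p \<noteq> 0" "eval_pol p u = 0" for p
    using that
  proof (induction p)
    case (pCons a p)
    show ?case
    proof (cases "a = 0")
      case True thus ?thesis using pCons assms by simp
    next
      case False
      have "of_pol a = u * (- eval_pol p u)" using pCons.prems by (simp add: eq_neg_iff_add_eq_0)
      thus ?thesis using False max_order_minus[OF max_order_eval_pol[OF assms(1), of p]] by blast
    qed
  qed simp
  obtain p where p: "lead_coeff p = 1" "eval_pol p u = 0" 
    using assms by (auto simp: max_order_iff)
  hence "p \<noteq> 0" by auto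
  from *[OF this p(2)] show ?thesis using that by blast
qed

lemma nonzero_idealD:
  assumes "nonzero_ideal y J"
  shows "u \<in> J \<Longrightarrow> u \<in> max_order y" "0 \<in> J" "u \<in> J \<Longrightarrow> v \<in> J \<Longrightarrow> u + v \<in> J"
    "z \<in> max_order y \<Longrightarrow> u \<in> J \<Longrightarrow> z * u \<in> J" "\<exists>u\<in>J. u \<noteq> 0"
  using assms unfolding nonzero_ideal_def by blast+

lemma ideal_contains_base:
  assumes "nonzero_ideal y J"
  obtains n where "n \<noteq> 0" "of_pol n \<in> J"
proof -
  obtain u where u: "u \<in> J" "u \<noteq> 0" using nonzero_idealD(5)[OF assms] by blast
  then obtain n v where "n \<noteq> 0" "v \<in> max_order y" "of_pol n = u * v"
    using multiple_in_base nonzero_idealD(1)[OF assms] by blast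
  thus ?thesis using that nonzero_idealD(4)[OF assms _ u(1), of v] by (simp add: mult.commute)
qed

lemma ideal_basis:
  assumes J: "nonzero_ideal y J"
  obtains M where "det M \<noteq> 0" "is_pol_basis (lincombs (fract_mat M) b) J"
proof -
  obtain n where n: "n \<noteq> 0" "of_pol n \<in> J" by (rule ideal_contains_base[OF J])
  define S where "S = {p. lincomb (fract_vec p) b \<in> J}"
  obtain M where M: "det M \<noteq> 0" "S = range (\<lambda>c. c v* M)"
  proof (rule triangular_basis[of S n])
    show "p + q \<in> S" if "p \<in> S" "q \<in> S" for p q
      using that nonzero_idealD(3)[OF J] by (simp add: S_def fract_vec_add lincomb_add)
    show "c *s p \<in> S" if "p \<in> S" for c p
      using that nonzero_idealD(4)[OF J max_order_of_pol] by (simp add: S_def fract_vec_scale lincomb_scale)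
    show "n *s p \<in> S" for p
      using nonzero_idealD(4)[OF J _ n(2), of "lincomb (fract_vec p) b"]
      by (simp add: S_def fract_vec_scale lincomb_scale max_order_eq mult.commute)
  qed (use n in auto)
  have "J = (\<lambda>p. lincomb (fract_vec p) b) ` S"
    using nonzero_idealD(1)[OF J] unfolding S_def max_order_eq by blast
  also have "\<dots> = range (\<lambda>p. lincomb (fract_vec p) (lincombs (fract_mat M) b))"
    by (simp add: M(2) image_image fract_vec_mult lincomb_lincombs)
  finally have "is_pol_basis (lincombs (fract_mat M) b) J"
    unfolding is_pol_basis_iff independent_lincombs_iff[OF independent_basis] det_fract_mat
    using M(1) by simp
  thus ?thesis using that M(1) by blast
qed

lemma basis_mem:
  assumes c: "is_pol_basis c J"
  shows "c $ i \<in> J"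
proof -
  have "lincomb (fract_vec (\<chi> j. if j = i then 1 else 0)) c = (\<Sum>j\<in>UNIV. if j = i then c $ j else 0)"
    unfolding lincomb_def by (rule sum.cong) auto
  also have "\<dots> = c $ i" by simp
  finally have "c $ i = lincomb (fract_vec (\<chi> j. if j = i then 1 else 0)) c" ..
  thus ?thesis using c unfolding is_pol_basis_iff by blast
qed

text \<open>
  Multiplication by \<open>z\<close> has a polynomial matrix with respect to a basis of \<open>J\<close>, and \<open>z\<close> is a root of
  its characteristic polynomial, here written out for size 3.
\<close>

lemma max_order_if_stabilises:
  assumes J: "nonzero_ideal y J" and z: "z \<in> function_field y" and st: "\<And>u. u \<in> J \<Longrightarrow> z * u \<in> J"
  shows "z \<in> max_order y"
proof -
  obtain M where M: "is_pol_basis (lincombs (fract_mat M) b) J" by (rule ideal_basis[OF J])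
  define c where "c = lincombs (fract_mat M) b"
  have c: "is_pol_basis c J" using M by (simp add: c_def)
  have "\<exists>p. z * c $ i = lincomb (fract_vec p) c" for i
    using st[OF basis_mem[OF c]] c unfolding is_pol_basis_iff by blast
  then obtain N where N: "\<And>i. z * c $ i = lincomb (fract_vec (N i)) c" by metis
  define p where "p = [: - (N 1$1 * N 2$2 * N 3$3 + N 1$2 * N 2$3 * N 3$1 + N 1$3 * N 2$1 * N 3$2
      - N 1$1 * N 2$3 * N 3$2 - N 1$2 * N 2$1 * N 3$3 - N 1$3 * N 2$2 * N 3$1),
      N 1$1 * N 2$2 + N 1$1 * N 3$3 + N 2$2 * N 3$3 - N 1$2 * N 2$1 - N 1$3 * N 3$1 - N 2$3 * N 3$2,
      - (N 1$1 + N 2$2 + N 3$3), 1:]"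
  define D :: "'k rf_closure ^ 3 ^ 3" where "D = (\<chi> i j. (if i = j then z else 0) - of_pol (N i $ j))"
  have "(D *v c) $ i = 0" for i
  proof -
    have "(D *v c) $ i = z * c $ i - lincomb (fract_vec (N i)) c"
      using exhaust_3[of i] by (auto simp: D_def matrix_vector_mult_def lincomb_def sum_3 algebra_simps)
    thus ?thesis using N by simp
  qed
  hence "c v* transpose D = 0" by (simp add: vec_eq_iff)
  moreover have "c \<noteq> 0" 
  proof
    assume "c = 0"
    hence "lincomb (vector [1, 0, 0]) c = 0" by (simp add: lincomb_def)
    hence "vector [1, 0, 0] = (0 :: 'k poly fract ^ 3)"
      using c unfolding is_pol_basis_iff independent_over_rf_def by blast
    thus False by (metis vector_3(1) zero_index zero_neq_one)
  qed
  ultimately have "det D = 0" using det_eq_0_iff_kernel[of "transpose D"] by (auto simp: det_transpose)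
  moreover have "eval_pol p z = det D"
    by (simp add: p_def D_def det_3 algebra_simps)
  ultimately have "eval_pol p z = 0" by simp
  moreover have "lead_coeff p = 1" by (simp add: p_def)
  ultimately show ?thesis using z unfolding max_order_iff by blast
qed


section \<open>Inverses of proper ideals\<close>

definition base_multiples :: "'k poly \<Rightarrow> 'k rf_closure set" where
  "base_multiples n = (\<lambda>t. of_pol n * t) ` max_order y"

lemma base_multiples_mult:
  assumes "x \<in> base_multiples n" "w \<in> max_order y"
  shows "x * w \<in> base_multiples n"
  using assms max_order_mult by (auto simp: base_multiples_def mult.assoc)

text \<open>
  The residue ring of the maximal order modulo \<open>n\<close> is finite, so two powers of \<open>u\<close> agree in it.
\<close>

lemma power_congruence:
  assumes u: "u \<in> max_order y" and n: "n \<noteq> 0"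
  obtains l m where "m > 0" "u ^ l * (1 - u ^ m) \<in> base_multiples n"
proof -
  have "\<exists>p. u ^ k = lincomb (fract_vec p) b" for k
    using max_order_power[OF u, of k] unfolding max_order_eq by blast
  then obtain p where p: "\<And>k. u ^ k = lincomb (fract_vec (p k)) b" by metis
  define r where "r k = (\<chi> j. p k $ j mod n)" for k
  have "degree (x mod n) \<le> degree n" for x using degree_mod_less[OF n, of x] by auto
  hence "range r \<subseteq> {v. \<forall>j. v $ j \<in> {q. degree q \<le> degree n}}"
    by (auto simp: r_def)
  hence "finite (range r)"
    by (rule finite_subset[OF _ finite_vec_3[OF finite_polys_degree_le]])
  hence "\<not> inj r" using range_inj_infinite by blast
  then obtain k l where kl: "k < l" "r k = r l"
    unfolding inj_def by (metis linorder_neqE_nat)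
  have "p k $ j mod n = p l $ j mod n" for j
    using kl(2) unfolding r_def vec_eq_iff by simp
  hence "n dvd p k $ j - p l $ j" for j by (simp add: mod_eq_dvd_iff)
  hence w: "p k - p l = n *s (\<chi> j. (p k $ j - p l $ j) div n)" (is "_ = n *s ?w")
    by (simp add: vec_eq_iff)
  have "u ^ k - u ^ l = lincomb (fract_vec (p k - p l)) b" by (simp add: p fract_vec_diff lincomb_diff)
  also have "\<dots> = of_pol n * lincomb (fract_vec ?w) b" unfolding w fract_vec_scale lincomb_scale ..
  finally have "u ^ k - u ^ l = of_pol n * lincomb (fract_vec ?w) b" .
  moreover have "u ^ k * (1 - u ^ (l - k)) = u ^ k - u ^ l"
    using kl(1) by (simp add: right_diff_distrib flip: power_add)
  ultimately have "u ^ k * (1 - u ^ (l - k)) = of_pol n * lincomb (fract_vec ?w) b" by (simp only:)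
  hence "u ^ k * (1 - u ^ (l - k)) \<in> base_multiples n"
    unfolding base_multiples_def max_order_eq by (intro image_eqI[OF _ rangeI])
  thus ?thesis using that kl(1) by (meson zero_less_diff)
qed

text \<open>
  The witness is a product of factors \<open>1 - u\<^sup>m\<close>, one for each \<open>u\<close> in \<open>G\<close>: it is 1 modulo \<open>J\<close>, and each
  factor kills a power of its \<open>u\<close>.
\<close>

lemma annihilate_powers:
  assumes J: "nonzero_ideal y J" and n: "n \<noteq> 0" and G: "finite G" "G \<subseteq> J"
  shows "\<exists>r\<in>max_order y. 1 - r \<in> J \<and> (\<forall>u\<in>G. \<exists>l. r * u ^ l \<in> base_multiples n)"
  using G
proof induction
  case empty
  show ?case by (rule bexI[of _ 1]) (simp_all add: nonzero_idealD(2)[OF J] max_order_1)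
next
  case (insert u G)
  then obtain r where r: "r \<in> max_order y" "1 - r \<in> J" "\<And>v. v \<in> G \<Longrightarrow> \<exists>l. r * v ^ l \<in> base_multiples n"
    by auto
  have uJ: "u \<in> J" and u: "u \<in> max_order y" using insert.prems nonzero_idealD(1)[OF J] by auto
  obtain l m where lm: "m > 0" "u ^ l * (1 - u ^ m) \<in> base_multiples n"
    by (rule power_congruence[OF u n])
  define r' where "r' = r * (1 - u ^ m)"
  have um: "1 - u ^ m \<in> max_order y" by (intro max_order_diff max_order_1 max_order_power u)
  have "r * u ^ (m - 1) * u \<in> J"
    by (intro nonzero_idealD(4)[OF J _ uJ] max_order_mult max_order_power u r)
  hence "(1 - r) + r * u ^ (m - 1) * u \<in> J" by (rule nonzero_idealD(3)[OF J r(2)])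
  moreover have "(1 - r) + r * u ^ (m - 1) * u = 1 - r'"
    using lm(1) unfolding r'_def by (cases m) (simp_all add: algebra_simps)
  ultimately have 1: "1 - r' \<in> J" by (simp only:)
  have "u ^ l * (1 - u ^ m) * r \<in> base_multiples n" by (rule base_multiples_mult[OF lm(2) r(1)])
  moreover have "u ^ l * (1 - u ^ m) * r = r' * u ^ l" by (simp add: r'_def)
  ultimately have 2: "\<exists>l. r' * u ^ l \<in> base_multiples n" by metis
  have 3: "\<exists>l. r' * v ^ l \<in> base_multiples n" if "v \<in> G" for v
  proof -
    obtain l where l: "r * v ^ l \<in> base_multiples n" using r(3)[OF \<open>v \<in> G\<close>] by blast
    have "r * v ^ l * (1 - u ^ m) = r' * v ^ l" by (simp add: r'_def)
    thus ?thesis using base_multiples_mult[OF l um] by metis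
  qed
  have "r' \<in> max_order y" unfolding r'_def by (intro max_order_mult r um)
  thus ?case using 1 2 3 by blast
qed

text \<open>
  Multiply \<open>r\<close> by each generator in turn as often as the product remains nonzero modulo \<open>n\<close>.
\<close>

lemma maximal_nonmultiple:
  assumes "finite G" "G \<subseteq> max_order y" "r \<in> max_order y" "r \<notin> base_multiples n"
    and "\<And>u. u \<in> G \<Longrightarrow> \<exists>l. r * u ^ l \<in> base_multiples n"
  shows "\<exists>t\<in>max_order y. r * t \<notin> base_multiples n \<and> (\<forall>u\<in>G. r * t * u \<in> base_multiples n)"
  using assms
proof (induction arbitrary: r)
  case empty
  show ?case by (rule bexI[of _ 1]) (use empty.prems in \<open>simp_all add: max_order_1\<close>)
next
  case (insert u G)
  have u: "u \<in> max_order y" using insert.prems by simp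
  (* l is positive since r itself is no multiple of n; the power l - 1 is kept *)
  obtain l where l: "r * u ^ l \<in> base_multiples n" "\<And>k. k < l \<Longrightarrow> r * u ^ k \<notin> base_multiples n"
    using insert.prems(4)[of u] exists_least_iff[of "\<lambda>l. r * u ^ l \<in> base_multiples n"] by auto
  have "l \<noteq> 0" using l(1) insert.prems(3) by (intro notI) simp
  then obtain k where k: "l = Suc k" by (cases l) auto
  define r1 where "r1 = r * u ^ k"
  have uk: "u ^ k \<in> max_order y" by (rule max_order_power[OF u])
  have "\<exists>t\<in>max_order y. r1 * t \<notin> base_multiples n \<and> (\<forall>u\<in>G. r1 * t * u \<in> base_multiples n)"
  proof (rule insert.IH)
    show "G \<subseteq> max_order y" using insert.prems by simp
    show "r1 \<in> max_order y" unfolding r1_def by (intro max_order_mult uk insert.prems)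
    show "r1 \<notin> base_multiples n" unfolding r1_def using l(2)[of k] k by simp
    fix v assume "v \<in> G"
    then obtain j where j: "r * v ^ j \<in> base_multiples n" using insert.prems(4) by blast
    have "r * v ^ j * u ^ k = r1 * v ^ j" by (simp add: r1_def)
    thus "\<exists>l. r1 * v ^ l \<in> base_multiples n" using base_multiples_mult[OF j uk] by metis
  qed
  then obtain t where t: "t \<in> max_order y" "r1 * t \<notin> base_multiples n"
    "\<And>v. v \<in> G \<Longrightarrow> r1 * t * v \<in> base_multiples n" by blast
  have eq: "r * (u ^ k * t) = r1 * t" by (simp add: r1_def)
  have "r * u ^ l * t \<in> base_multiples n" by (rule base_multiples_mult[OF l(1) t(1)])
  moreover have "r * u ^ l * t = r1 * t * u" by (simp add: r1_def k)
  ultimately have "r1 * t * u \<in> base_multiples n" by (simp only:)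
  hence "\<forall>v\<in>insert u G. r * (u ^ k * t) * v \<in> base_multiples n"
    unfolding eq using t(3) by blast
  moreover have "r * (u ^ k * t) \<notin> base_multiples n" unfolding eq by (rule t(2))
  moreover have "u ^ k * t \<in> max_order y" by (intro max_order_mult uk t)
  ultimately show ?case by blast
qed

text \<open>
  For proper \<open>J\<close> containing \<open>n\<close>, an element congruent to 1 modulo \<open>J\<close> is nonzero modulo \<open>n\<close>. So there is
  an element outside \<open>\<langle>n\<rangle>\<close> which all generators of \<open>J\<close> multiply into \<open>\<langle>n\<rangle>\<close>; dividing it by \<open>n\<close>
  gives \<open>z\<close>.
\<close>

lemma proper_ideal_inverse:
  assumes J: "nonzero_ideal y J" and proper: "1 \<notin> J"
  obtains z where "z \<in> function_field y" "z \<notin> max_order y" "\<And>u. u \<in> J \<Longrightarrow> z * u \<in> max_order y"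
proof -
  obtain n where n: "n \<noteq> 0" "of_pol n \<in> J" by (rule ideal_contains_base[OF J])
  obtain M where M: "is_pol_basis (lincombs (fract_mat M) b) J" by (rule ideal_basis[OF J])
  define c where "c = lincombs (fract_mat M) b"
  have c: "is_pol_basis c J" using M by (simp add: c_def)
  define G where "G = range (\<lambda>i. c $ i)"
  have G: "finite G" "G \<subseteq> J" unfolding G_def using basis_mem[OF c] by auto
  hence GO: "G \<subseteq> max_order y" using nonzero_idealD(1)[OF J] by blast
  obtain r where r: "r \<in> max_order y" "1 - r \<in> J" "\<And>u. u \<in> G \<Longrightarrow> \<exists>l. r * u ^ l \<in> base_multiples n"
    using annihilate_powers[OF J n(1) G] by blast
  have "r \<notin> base_multiples n"
  proof
    assume "r \<in> base_multiples n"
    then obtain t where "t \<in> max_order y" "r = of_pol n * t" unfolding base_multiples_def by blast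
    hence "r \<in> J" using nonzero_idealD(4)[OF J _ n(2), of t] by (simp add: mult.commute)
    from nonzero_idealD(3)[OF J r(2) this] show False using proper by simp
  qed
  from maximal_nonmultiple[OF G(1) GO r(1) this r(3)] obtain t where
    t: "t \<in> max_order y" "r * t \<notin> base_multiples n" "\<And>u. u \<in> G \<Longrightarrow> r * t * u \<in> base_multiples n"
    by blast
  define z where "z = r * t / of_pol n"
  have nz: "of_pol n \<noteq> 0" using n by simp
  have rt: "r * t = of_pol n * z" using nz by (simp add: z_def)
  have "z \<in> function_field y" unfolding z_def
    by (intro function_field_divide function_field.mult max_order_subset[OF r(1)] 
        max_order_subset[OF t(1)] function_field.base)
  moreover have "z \<notin> max_order y" using t(2) unfolding rt base_multiples_def by blast
  moreover have "z * u \<in> max_order y" if u: "u \<in> J" for u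
  proof -
    have zc: "z * c $ i \<in> max_order y" for i
    proof -
      have "r * t * c $ i \<in> base_multiples n" using t(3) unfolding G_def by blast
      then obtain x where "x \<in> max_order y" "of_pol n * z * c $ i = of_pol n * x"
        unfolding rt base_multiples_def by blast
      thus ?thesis using nz by (simp add: mult.assoc)
    qed
    obtain p where p: "u = lincomb (fract_vec p) c" using u c unfolding is_pol_basis_iff by blast
    have "z * u = of_pol (p$1) * (z * c$1) + of_pol (p$2) * (z * c$2) + of_pol (p$3) * (z * c$3)"
      unfolding p lincomb_def sum_3 by (simp add: algebra_simps)
    also have "\<dots> \<in> max_order y" by (intro max_order_add max_order_scale zc)
    finally show ?thesis .
  qed
  ultimately show ?thesis using that by blast
qed

end

section \<open>Products and inverses of ideals\<close>

lemma ideal_mult_0: "0 \<in> ideal_mult I J"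
  unfolding ideal_mult_def by (rule CollectI, rule exI[of _ 0]) simp

lemma ideal_mult_add_product:
  assumes "x \<in> ideal_mult I J" "u \<in> I" "v \<in> J"
  shows "x + u * v \<in> ideal_mult I J"
proof -
  obtain n :: nat and f g where x: "x = (\<Sum>k<n. f k * g k)" "\<And>k. k < n \<Longrightarrow> f k \<in> I \<and> g k \<in> J"
    using assms(1) unfolding ideal_mult_def by blast
  have "x + u * v = (\<Sum>k<Suc n. (f(n := u)) k * (g(n := v)) k)" by (simp add: x(1))
  moreover have "\<forall>k<Suc n. (f(n := u)) k \<in> I \<and> (g(n := v)) k \<in> J"
    using x(2) assms by (simp add: less_Suc_eq)
  ultimately show ?thesis unfolding ideal_mult_def by blast
qed

lemma ideal_mult_product: "u \<in> I \<Longrightarrow> v \<in> J \<Longrightarrow> u * v \<in> ideal_mult I J"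
  using ideal_mult_add_product[OF ideal_mult_0] by simp

lemma ideal_mult_induct [consumes 1, case_names zero add]:
  assumes "x \<in> ideal_mult I J" "P 0"
    and "\<And>x u v. P x \<Longrightarrow> u \<in> I \<Longrightarrow> v \<in> J \<Longrightarrow> P (x + u * v)"
  shows "P x"
proof -
  obtain n :: nat and f g where x: "x = (\<Sum>k<n. f k * g k)" "\<And>k. k < n \<Longrightarrow> f k \<in> I \<and> g k \<in> J"
    using assms(1) unfolding ideal_mult_def by blast
  have "m \<le> n \<Longrightarrow> P (\<Sum>k<m. f k * g k)" for m
    by (induction m) (use assms(2,3) x(2) in simp_all)
  thus ?thesis unfolding x(1) by blast
qed

lemma ideal_mult_add:
  assumes "x \<in> ideal_mult I J" "x' \<in> ideal_mult I J"
  shows "x + x' \<in> ideal_mult I J"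
  using assms(2)
proof (induction rule: ideal_mult_induct)
  case (add x' u v)
  have "x + x' + u * v \<in> ideal_mult I J" by (rule ideal_mult_add_product[OF add.IH add.hyps])
  thus ?case by (simp add: add.assoc)
qed (simp add: assms)

context ramified_cubic
begin

text \<open>
  Integral and fractional ideals at once: submodules of the field over the maximal order, without
  nonzeroness or a common denominator.
\<close>

definition order_module :: "'k rf_closure set \<Rightarrow> bool" where
  "order_module W \<longleftrightarrow> 0 \<in> W \<and> (\<forall>u\<in>W. \<forall>v\<in>W. u + v \<in> W) \<and> (\<forall>z\<in>max_order y. \<forall>u\<in>W. z * u \<in> W)"

lemma order_moduleD:
  assumes "order_module W"
  shows "0 \<in> W" "u \<in> W \<Longrightarrow> v \<in> W \<Longrightarrow> u + v \<in> W" "z \<in> max_order y \<Longrightarrow> u \<in> W \<Longrightarrow> z * u \<in> W"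
  using assms unfolding order_module_def by blast+

lemma nonzero_ideal_iff: "nonzero_ideal y J \<longleftrightarrow> order_module J \<and> J \<subseteq> max_order y \<and> (\<exists>u\<in>J. u \<noteq> 0)"
  unfolding nonzero_ideal_def order_module_def by blast

lemma order_module_ideal: "nonzero_ideal y J \<Longrightarrow> order_module J"
  by (simp add: nonzero_ideal_iff)

lemma order_module_ideal_mult:
  assumes "order_module W"
  shows "order_module (ideal_mult W V)"
  unfolding order_module_def
proof (intro conjI ballI)
  fix z x assume z: "z \<in> max_order y" and x: "x \<in> ideal_mult W V"
  from x show "z * x \<in> ideal_mult W V"
  proof (induction rule: ideal_mult_induct)
    case (add x u v)
    have "z * x + (z * u) * v \<in> ideal_mult W V"
      by (rule ideal_mult_add_product[OF add.IH order_moduleD(3)[OF assms z add.hyps(1)] add.hyps(2)])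
    thus ?case by (simp add: algebra_simps)
  qed (simp add: ideal_mult_0)
qed (simp_all add: ideal_mult_0 ideal_mult_add)

lemma order_module_scale:
  assumes "order_module W"
  shows "order_module ((\<lambda>u. g * u) ` W)"
  unfolding order_module_def
proof (intro conjI ballI)
  show "0 \<in> (\<lambda>u. g * u) ` W" using order_moduleD(1)[OF assms] by (intro image_eqI[of _ _ 0]) auto
next
  fix x x' assume "x \<in> (\<lambda>u. g * u) ` W" "x' \<in> (\<lambda>u. g * u) ` W"
  then obtain u u' where u: "u \<in> W" "u' \<in> W" "x = g * u" "x' = g * u'" by blast
  show "x + x' \<in> (\<lambda>u. g * u) ` W"
    by (rule image_eqI[OF _ order_moduleD(2)[OF assms u(1,2)]]) (simp add: u distrib_left)
next
  fix z x assume z: "z \<in> max_order y" and "x \<in> (\<lambda>u. g * u) ` W"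
  then obtain u where u: "u \<in> W" "x = g * u" by blast
  show "z * x \<in> (\<lambda>u. g * u) ` W"
    by (rule image_eqI[OF _ order_moduleD(3)[OF assms z u(1)]]) (simp add: u)
qed

lemma order_module_inverse: "order_module (ideal_inverse y W)"
  unfolding order_module_def
proof (intro conjI ballI)
  show "0 \<in> ideal_inverse y W" by (simp add: ideal_inverse_def function_field_0 max_order_0)
next
  fix u v assume "u \<in> ideal_inverse y W" "v \<in> ideal_inverse y W"
  thus "u + v \<in> ideal_inverse y W"
    by (simp add: ideal_inverse_def function_field.add distrib_right max_order_add)
next
  fix z u assume "z \<in> max_order y" "u \<in> ideal_inverse y W"
  thus "z * u \<in> ideal_inverse y W"
    by (simp add: ideal_inverse_def function_field.mult max_order_subset mult.assoc max_order_mult)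
qed

lemma ideal_mult_principal:
  assumes W: "order_module W"
  shows "ideal_mult (principal y g) W = (\<lambda>u. g * u) ` W"
proof (rule subset_antisym; rule subsetI)
  fix x assume "x \<in> ideal_mult (principal y g) W"
  thus "x \<in> (\<lambda>u. g * u) ` W"
  proof (induction rule: ideal_mult_induct)
    case zero
    show ?case by (rule order_moduleD(1)[OF order_module_scale[OF W]])
  next
    case (add x w v)
    then obtain z where z: "z \<in> max_order y" "w = g * z" unfolding principal_def by blast
    have "w * v \<in> (\<lambda>u. g * u) ` W"
      by (rule image_eqI[OF _ order_moduleD(3)[OF W z(1) add.hyps(2)]]) (simp add: z)
    thus ?case by (rule order_moduleD(2)[OF order_module_scale[OF W] add.IH])
  qed
next
  fix x assume "x \<in> (\<lambda>u. g * u) ` W"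
  then obtain u where u: "u \<in> W" "x = g * u" by blast
  have "g \<in> principal y g" unfolding principal_def
    by (rule image_eqI[OF _ max_order_1]) simp
  thus "x \<in> ideal_mult (principal y g) W" unfolding u(2) by (rule ideal_mult_product[OF _ u(1)])
qed

lemma nonzero_ideal_mult:
  assumes I: "nonzero_ideal y I" and J: "nonzero_ideal y J"
  shows "nonzero_ideal y (ideal_mult I J)"
proof -
  have "x \<in> max_order y" if "x \<in> ideal_mult I J" for x
    using that
  proof (induction rule: ideal_mult_induct)
    case (add x u v)
    thus ?case using nonzero_idealD(1)[OF I] nonzero_idealD(1)[OF J]
      by (intro max_order_add max_order_mult) blast+
  qed (rule max_order_0)
  moreover obtain u v where "u \<in> I" "u \<noteq> 0" "v \<in> J" "v \<noteq> 0"
    using nonzero_idealD(5)[OF I] nonzero_idealD(5)[OF J] by blast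
  hence "u * v \<in> ideal_mult I J \<and> u * v \<noteq> 0" by (simp add: ideal_mult_product)
  ultimately show ?thesis unfolding nonzero_ideal_iff
    using order_module_ideal_mult[OF order_module_ideal[OF I]] by blast
qed

text \<open>
  If \<open>H = JJ\<^sup>-\<^sup>1\<close> were proper, some \<open>z\<close> outside the maximal order would satisfy \<open>zJJ\<^sup>-\<^sup>1 \<subseteq> max_order y\<close>, that is,
  \<open>zJ\<^sup>-\<^sup>1 \<subseteq> J\<^sup>-\<^sup>1\<close>. Scaling \<open>J\<^sup>-\<^sup>1\<close> by an element of \<open>J\<close> gives an integral ideal stable under \<open>z\<close>, so
  \<open>z\<close> would be integral.
\<close>

lemma ideal_invertible:
  assumes J: "nonzero_ideal y J"
  shows "1 \<in> ideal_mult J (ideal_inverse y J)"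
proof (rule ccontr)
  let ?H = "ideal_mult J (ideal_inverse y J)"
  assume notin: "1 \<notin> ?H"
  obtain u0 where u0: "u0 \<in> J" "u0 \<noteq> 0" using nonzero_idealD(5)[OF J] by blast
  have one: "1 \<in> ideal_inverse y J"
    using nonzero_idealD(1)[OF J] by (simp add: ideal_inverse_def function_field_1)
  have "x \<in> max_order y" if "x \<in> ?H" for x
    using that
  proof (induction rule: ideal_mult_induct)
    case (add x u v)
    have "v * u \<in> max_order y" using add.hyps by (simp add: ideal_inverse_def)
    thus ?case using max_order_add[OF add.IH] by (simp add: mult.commute)
  qed (rule max_order_0)
  moreover have "u0 \<in> ?H" using ideal_mult_product[OF u0(1) one] by simp
  ultimately have H: "nonzero_ideal y ?H" unfolding nonzero_ideal_iff
    using order_module_ideal_mult[OF order_module_ideal[OF J]] u0(2) by blast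
  obtain z where z: "z \<in> function_field y" "z \<notin> max_order y" "\<And>u. u \<in> ?H \<Longrightarrow> z * u \<in> max_order y"
    using proper_ideal_inverse[OF H notin] by blast
  have stable: "z * v \<in> ideal_inverse y J" if v: "v \<in> ideal_inverse y J" for v
  proof -
    have "z * v * u \<in> max_order y" if u: "u \<in> J" for u
      using z(3)[OF ideal_mult_product[OF u v]] by (simp add: mult.assoc mult.commute[of u v])
    moreover have "z * v \<in> function_field y"
      using v z(1) by (simp add: ideal_inverse_def function_field.mult)
    ultimately show ?thesis by (simp add: ideal_inverse_def)
  qed
  define W where "W = (\<lambda>v. u0 * v) ` ideal_inverse y J"
  have "W \<subseteq> max_order y"
    using u0(1) by (auto simp: W_def ideal_inverse_def mult.commute)
  moreover have "u0 \<in> W" unfolding W_def by (rule image_eqI[OF _ one]) simp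
  ultimately have W: "nonzero_ideal y W" unfolding nonzero_ideal_iff
    using order_module_scale[OF order_module_inverse] u0(2) unfolding W_def by blast
  have "z * w \<in> W" if "w \<in> W" for w
  proof -
    obtain v where v: "v \<in> ideal_inverse y J" "w = u0 * v" using \<open>w \<in> W\<close> unfolding W_def by blast
    show ?thesis unfolding W_def
      by (rule image_eqI[OF _ stable[OF v(1)]]) (simp add: v(2))
  qed
  from max_order_if_stabilises[OF W z(1) this] z(2) show False by blast
qed

lemma ideal_double_inverse:
  assumes J: "nonzero_ideal y J"
  shows "ideal_inverse y (ideal_inverse y J) = J"
proof (rule subset_antisym; rule subsetI)
  fix z assume z: "z \<in> ideal_inverse y (ideal_inverse y J)"
  have "z * x \<in> J" if "x \<in> ideal_mult J (ideal_inverse y J)" for x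
    using that
  proof (induction rule: ideal_mult_induct)
    case (add x u v)
    have "z * v \<in> max_order y" using z add.hyps(2) unfolding ideal_inverse_def[of _ "ideal_inverse y J"] by blast
    from nonzero_idealD(4)[OF J this add.hyps(1)] 
    have "z * x + z * v * u \<in> J" by (rule nonzero_idealD(3)[OF J add.IH])
    thus ?case by (simp add: algebra_simps)
  qed (simp add: nonzero_idealD(2)[OF J])
  from this[OF ideal_invertible[OF J]] show "z \<in> J" by simp
next
  fix z assume z: "z \<in> J"
  hence "z \<in> function_field y" using nonzero_idealD(1)[OF J] max_order_subset by blast
  thus "z \<in> ideal_inverse y (ideal_inverse y J)"
    using z by (auto simp: ideal_inverse_def mult.commute)
qed

lemma ideal_inverse_scale:
  assumes g: "g \<in> function_field y" "g \<noteq> 0"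
  shows "ideal_inverse y ((\<lambda>u. g * u) ` W) = (\<lambda>u. inverse g * u) ` ideal_inverse y W"
proof (rule subset_antisym; rule subsetI)
  fix z assume z: "z \<in> ideal_inverse y ((\<lambda>u. g * u) ` W)"
  hence "g * z \<in> ideal_inverse y W"
    using g by (auto simp: ideal_inverse_def function_field.mult mult.assoc mult.left_commute)
  thus "z \<in> (\<lambda>u. inverse g * u) ` ideal_inverse y W"
    by (rule image_eqI[rotated]) (use g in simp)
next
  fix z assume "z \<in> (\<lambda>u. inverse g * u) ` ideal_inverse y W"
  then obtain u where u: "u \<in> ideal_inverse y W" "z = inverse g * u" by blast
  have "z * (g * w) \<in> max_order y" if w: "w \<in> W" for w
  proof -
    have eq: "z * (g * w) = u * w" using g by (simp add: u(2))
    show ?thesis unfolding eq using u(1) w by (simp add: ideal_inverse_def)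
  qed
  moreover have "z \<in> function_field y"
    using u g by (simp add: ideal_inverse_def function_field.mult function_field.inverse)
  ultimately show "z \<in> ideal_inverse y ((\<lambda>u. g * u) ` W)"
    unfolding ideal_inverse_def by blast
qed

section \<open>Degrees of ideal norms\<close>

lemma lincombs_mat_1: "lincombs (mat 1) c = c"
proof -
  have "lincombs (mat 1) c $ i = (\<Sum>j\<in>UNIV. if i = j then c $ j else 0)" for i
    unfolding lincombs_nth lincomb_def by (rule sum.cong) (auto simp: mat_def)
  thus ?thesis by (simp add: vec_eq_iff)
qed

lemma fract_mat_1: "fract_mat (mat 1) = mat 1"
  by (simp add: vec_eq_iff mat_def)

lemma change_of_basis:
  assumes c: "is_pol_basis c S" and c': "is_pol_basis c' S"
  obtains U where "c' = lincombs (fract_mat U) c" "is_unit (det U)"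
proof -
  have "\<exists>p. c' $ i = lincomb (fract_vec p) c" for i
    using basis_mem[OF c'] c unfolding is_pol_basis_iff by blast
  then obtain u where u: "\<And>i. c' $ i = lincomb (fract_vec (u i)) c" by metis
  have "\<exists>p. c $ i = lincomb (fract_vec p) c'" for i
    using basis_mem[OF c] c' unfolding is_pol_basis_iff by blast
  then obtain v where v: "\<And>i. c $ i = lincomb (fract_vec (v i)) c'" by metis
  define U V where "U = (\<chi> i. u i)" and "V = (\<chi> i. v i)"
  have U: "c' = lincombs (fract_mat U) c" using u by (simp add: vec_eq_iff U_def)
  have V: "c = lincombs (fract_mat V) c'" using v by (simp add: vec_eq_iff V_def)
  have "lincombs (fract_mat (V ** U)) c = lincombs (mat 1) c"
    unfolding lincombs_mat_1 fract_mat_mult lincombs_lincombs[symmetric] U[symmetric] V[symmetric] ..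
  hence "fract_mat (V ** U) = mat 1"
    using c unfolding is_pol_basis_iff by (blast intro: independent_lincombs_eq)
  hence "V ** U = mat 1" unfolding fract_mat_1[symmetric] fract_mat_eq_iff .
  hence "det V * det U = 1" by (metis det_I det_mul)
  hence "is_unit (det U)" by (metis dvd_triv_right)
  thus ?thesis using U that by blast
qed

text \<open>
  Different choices of bases change the determinant by units only, so the normalised determinant in the
  definition of the ideal norm is unique.
\<close>

lemma degree_ideal_norm:
  assumes J: "nonzero_ideal y J" and M: "is_pol_basis (lincombs (fract_mat M) b) J"
  shows "degree (ideal_norm y J) = degree (det M)"
proof -
  have det: "det M \<noteq> 0"
    using M unfolding is_pol_basis_iff independent_lincombs_iff[OF independent_basis] det_fract_mat by simp
  define n where "n = smult (inverse (lead_coeff (det M))) (det M)"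
  have n: "lead_coeff n = 1" using det by (simp add: n_def)
  have dvd_n: "n dvd det M" "det M dvd n"
    using det by (simp_all add: n_def smult_dvd_iff dvd_smult)
  have "ideal_norm y J = n"
    unfolding ideal_norm_def
  proof (rule the_equality)
    have "det M = smult (lead_coeff (det M)) n" using det by (simp add: n_def)
    moreover have "\<forall>i. lincombs (fract_mat M) b $ i = (\<Sum>j\<in>UNIV. of_pol (M $ i $ j) * b $ j)"
      by (simp add: lincomb_def)
    ultimately show "lead_coeff n = 1 \<and> (\<exists>b c (M :: 'k poly ^ 3 ^ 3) k. is_pol_basis b (max_order y) \<and>
        is_pol_basis c J \<and> (\<forall>i. c $ i = (\<Sum>j\<in>UNIV. of_pol (M $ i $ j) * b $ j)) \<and> det M = smult k n)"
      using n basis M by blast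
  next
    fix n'
    assume "lead_coeff n' = 1 \<and> (\<exists>b c (M :: 'k poly ^ 3 ^ 3) k. is_pol_basis b (max_order y) \<and>
        is_pol_basis c J \<and> (\<forall>i. c $ i = (\<Sum>j\<in>UNIV. of_pol (M $ i $ j) * b $ j)) \<and> det M = smult k n')"
    then obtain b' c' M' k where *: "lead_coeff n' = 1" "is_pol_basis b' (max_order y)" "is_pol_basis c' J"
      "\<And>i. c' $ i = (\<Sum>j\<in>UNIV. of_pol (M' $ i $ j) * b' $ j)" "det M' = smult k n'" by blast
    have c': "c' = lincombs (fract_mat M') b'" using *(4) by (simp add: vec_eq_iff lincomb_def)
    obtain U where U: "c' = lincombs (fract_mat U) (lincombs (fract_mat M) b)" "is_unit (det U)"
      by (rule change_of_basis[OF M *(3)])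
    obtain V where V: "b' = lincombs (fract_mat V) b" "is_unit (det V)"
      by (rule change_of_basis[OF basis *(2)])
    have "lincombs (fract_mat (M' ** V)) b = lincombs (fract_mat (U ** M)) b"
      using c' U(1) unfolding V(1) fract_mat_mult lincombs_lincombs by simp
    hence "M' ** V = U ** M"
      using independent_lincombs_eq[OF independent_basis] fract_mat_eq_iff by blast
    hence eq: "det M' * det V = det U * det M" by (metis det_mul)
    have k: "k \<noteq> 0" using eq det U(2) *(5) by auto
    have "det M' dvd det M" "det M dvd det M'"
      using U(2) V(2) by (metis eq dvd_triv_left dvd_mult_unit_iff' dvd_triv_right dvd_mult_unit_iff)+
    hence "n' dvd det M" "det M dvd n'"
      using k unfolding *(5) by (simp_all add: smult_dvd_iff dvd_smult_iff)
    thus "n' = n"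
      using n *(1) dvd_n by (intro monic_dvd_antisym) (auto intro: dvd_trans)
  qed
  thus ?thesis using det by (simp add: n_def)
qed

text \<open>
  The transition matrices from the power basis to \<open>gJ\<close> through \<open>b\<close> and through \<open>J\<close> have the same
  determinant up to a unit, and the second contains the multiplication matrix of \<open>g\<close>.
\<close>

lemma degree_ideal_norm_scale:
  assumes J: "nonzero_ideal y J" and g: "g \<in> function_field y" "g \<noteq> 0"
    and gJ: "nonzero_ideal y ((\<lambda>u. g * u) ` J)"
  shows "int (degree (ideal_norm y ((\<lambda>u. g * u) ` J))) = int (degree (ideal_norm y J)) + norm_degree g"
proof -
  obtain M where M: "det M \<noteq> 0" "is_pol_basis (lincombs (fract_mat M) b) J" by (rule ideal_basis[OF J])
  obtain M1 where M1: "det M1 \<noteq> 0" "is_pol_basis (lincombs (fract_mat M1) b) ((\<lambda>u. g * u) ` J)"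
    by (rule ideal_basis[OF gJ])
  have "(\<lambda>u. g * u) ` J = range (\<lambda>p. lincomb (fract_vec p) (\<chi> i. g * lincombs (fract_mat M) b $ i))"
    using M(2) unfolding is_pol_basis_iff lincomb_times_basis by (simp add: image_image)
  moreover have "independent_over_rf (\<chi> i. g * lincombs (fract_mat M) b $ i)"
    using M(2) g(2) unfolding is_pol_basis_iff independent_over_rf_def lincomb_times_basis by simp
  ultimately have "is_pol_basis (\<chi> i. g * lincombs (fract_mat M) b $ i) ((\<lambda>u. g * u) ` J)"
    unfolding is_pol_basis_iff by blast
  from change_of_basis[OF this M1(2)]
  obtain U where U: "lincombs (fract_mat M1) b = lincombs (fract_mat U) (\<chi> i. g * lincombs (fract_mat M) b $ i)"
    "is_unit (det U)" .
  have "\<exists>v. b $ i = elt v" for i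
    using max_order_subset[OF basis_mem[OF basis]] by (auto simp: function_field_eq)
  then obtain q where q: "\<And>i. b $ i = elt (q i)" by metis
  define Q where "Q = (\<chi> i. q i)"
  have b: "b = lincombs Q (power_basis y)" using q by (simp add: vec_eq_iff Q_def elt_def)
  have Q: "det Q \<noteq> 0"
    using independent_basis unfolding b independent_lincombs_iff[OF independent_power_basis] .
  have "lincombs (fract_mat M1 ** Q) (power_basis y)
      = lincombs (fract_mat U ** fract_mat M ** Q ** mult_matrix y g) (power_basis y)"
    using U(1) unfolding b lincombs_times_basis[symmetric] mult_matrix_basis[OF g(1)] lincombs_lincombs
    by (simp add: matrix_mul_assoc)
  hence "fract_mat M1 ** Q = fract_mat U ** fract_mat M ** Q ** mult_matrix y g"
    by (rule independent_lincombs_eq[OF independent_power_basis])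
  hence "det (fract_mat M1) * det Q = det (fract_mat U) * det (fract_mat M) * det Q * field_norm y g"
    unfolding field_norm_def by (metis det_mul)
  hence "to_fract (det M1) = to_fract (det U * det M) * field_norm y g"
    using Q by (simp add: det_fract_mat)
  hence "int (degree (det M1)) = int (degree (det U * det M)) + norm_degree g"
    using M(1) M1(1) U(2) field_norm_nz[OF g] unfolding norm_degree_def
    by (metis rf_degree_to_fract rf_degree_mult to_fract_eq_0_iff mult_eq_0_iff not_is_unit_0)
  moreover have "degree (det U * det M) = degree (det M)"
  proof -
    have "det U \<noteq> 0" using U(2) by auto
    moreover from this have "degree (det U) = 0" using U(2) by (simp add: is_unit_iff_degree)
    ultimately show ?thesis using M(1) by (simp add: degree_mult_eq)
  qed
  ultimately show ?thesis using degree_ideal_norm[OF J M(2)] degree_ideal_norm[OF gJ M1(2)] by simp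
qed

section \<open>Minimal elements give distinguished ideals\<close>

text \<open>
  Writing \<open>\<alpha> = sg\<close> with \<open>g\<close> in \<open>\<aa>\<^sup>-\<^sup>1\<close>, the double inverse gives \<open>J = g\<aa>\<close>. An integral ideal \<open>hJ\<close> of at
  most the norm degree of \<open>J\<close> yields \<open>h\<alpha>\<close> in \<open>\<aa>'\<close> of at most the norm degree of \<open>\<alpha>\<close>, and cancelling its
  leading term against \<open>\<alpha>\<close> shows that \<open>h\<close> is constant.
\<close>

lemma minimal_element_distinguished:
  assumes a: "nonzero_ideal y \<aa>" and s: "s \<noteq> 0"
    and a': "\<aa>' = ideal_mult (principal y (of_pol s)) (ideal_inverse y \<aa>)"
    and \<alpha>: "\<alpha> \<in> \<aa>'" "\<alpha> \<noteq> 0"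
    and min: "\<And>\<beta>. \<beta> \<in> \<aa>' \<Longrightarrow> \<beta> \<noteq> 0 \<Longrightarrow> norm_degree \<alpha> \<le> norm_degree \<beta>"
    and J: "J = ideal_mult (principal y \<alpha>) (ideal_inverse y \<aa>')"
  shows "is_distinguished_ideal_of_class y J \<aa>"
proof -
  have s0: "of_pol s \<noteq> 0" using s by simp
  have a'_eq: "\<aa>' = (\<lambda>u. of_pol s * u) ` ideal_inverse y \<aa>"
    unfolding a' by (rule ideal_mult_principal[OF order_module_inverse])
  have a'_module: "order_module \<aa>'"
    unfolding a'_eq by (rule order_module_scale[OF order_module_inverse])
  obtain g where g: "g \<in> ideal_inverse y \<aa>" "\<alpha> = of_pol s * g" using \<alpha>(1) unfolding a'_eq by blast
  have g0: "g \<noteq> 0" using \<alpha>(2) g by auto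
  have gF: "g \<in> function_field y" using g(1) by (simp add: ideal_inverse_def)
  have \<alpha>F: "\<alpha> \<in> function_field y" unfolding g(2) by (intro function_field.mult function_field.base gF)
  have "ideal_inverse y \<aa>' = (\<lambda>u. inverse (of_pol s) * u) ` \<aa>"
    unfolding a'_eq ideal_inverse_scale[OF function_field.base s0] ideal_double_inverse[OF a] ..
  moreover have "\<alpha> * (inverse (of_pol s) * u) = g * u" for u using s0 by (simp add: g(2))
  ultimately have J_eq: "J = (\<lambda>u. g * u) ` \<aa>"
    unfolding J ideal_mult_principal[OF order_module_inverse] by (simp only: image_image)
  have same: "same_class y J \<aa>"
    unfolding same_class_def J_eq using ideal_mult_principal[OF order_module_ideal[OF a], of g] gF g0 by blast
  have J_ideal: "nonzero_ideal y J"
  proof -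
    have "J \<subseteq> max_order y" using g(1) unfolding J_eq by (auto simp: ideal_inverse_def)
    moreover have "\<exists>u\<in>J. u \<noteq> 0" using nonzero_idealD(5)[OF a] g0 unfolding J_eq by auto
    moreover have "order_module J" unfolding J_eq by (rule order_module_scale[OF order_module_ideal[OF a]])
    ultimately show ?thesis unfolding nonzero_ideal_iff by blast
  qed
  have dist: "distinguished y J"
    unfolding distinguished_def
  proof (intro conjI allI impI J_ideal, elim conjE)
    fix J1 assume J1: "nonzero_ideal y J1" "same_class y J1 J"
      and le: "degree (ideal_norm y J1) \<le> degree (ideal_norm y J)"
    obtain h where h: "h \<in> function_field y" "h \<noteq> 0" and "J1 = ideal_mult (principal y h) J"
      using J1(2) unfolding same_class_def by blast
    hence J1_eq: "J1 = (\<lambda>u. h * u) ` J"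
      using ideal_mult_principal[OF order_module_ideal[OF J_ideal]] by simp
    have "int (degree (ideal_norm y J1)) = int (degree (ideal_norm y J)) + norm_degree h"
      using degree_ideal_norm_scale[OF J_ideal h] J1(1) unfolding J1_eq by blast
    hence h_le: "norm_degree h \<le> 0" using le by simp
    have "h * g \<in> ideal_inverse y \<aa>"
    proof -
      have "h * g * u \<in> max_order y" if "u \<in> \<aa>" for u
      proof -
        have "h * (g * u) \<in> J1" unfolding J1_eq J_eq using that by blast
        thus ?thesis using nonzero_idealD(1)[OF J1(1)] by (simp add: mult.assoc)
      qed
      thus ?thesis using function_field.mult[OF h(1) gF] by (simp add: ideal_inverse_def)
    qed
    hence h\<alpha>: "h * \<alpha> \<in> \<aa>'" unfolding a'_eq by (rule image_eqI[rotated]) (simp add: g(2))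
    have h\<alpha>0: "h * \<alpha> \<noteq> 0" and h\<alpha>F: "h * \<alpha> \<in> function_field y"
      using h \<alpha>(2) \<alpha>F by (simp_all add: function_field.mult)
    have "norm_degree (h * \<alpha>) = norm_degree h + norm_degree \<alpha>"
      by (rule norm_degree_mult[OF h(1) \<alpha>F h(2) \<alpha>(2)])
    hence eq: "norm_degree (h * \<alpha>) = norm_degree \<alpha>" using min[OF h\<alpha> h\<alpha>0] h_le by simp
    obtain k where k: "h * \<alpha> - of_pol [:k:] * \<alpha> = 0 \<or>
        norm_degree (h * \<alpha> - of_pol [:k:] * \<alpha>) < norm_degree (h * \<alpha>)"
      by (rule norm_degree_cancel[OF h\<alpha>F \<alpha>F h\<alpha>0 \<alpha>(2) eq])
    have "of_pol [:- k:] * \<alpha> \<in> \<aa>'" by (rule order_moduleD(3)[OF a'_module max_order_of_pol \<alpha>(1)])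
    from order_moduleD(2)[OF a'_module h\<alpha> this]
    have diff: "h * \<alpha> - of_pol [:k:] * \<alpha> \<in> \<aa>'"
      using to_fract_uminus[of "[:k:]"] by simp
    have "h * \<alpha> - of_pol [:k:] * \<alpha> = 0"
    proof (rule ccontr)
      assume "h * \<alpha> - of_pol [:k:] * \<alpha> \<noteq> 0"
      from min[OF diff this] k this eq show False by simp
    qed
    hence hk: "h = of_pol [:k:]" using \<alpha>(2) by simp
    hence k0: "k \<noteq> 0" using h(2) by auto
    have "[:k:] * [:1/k:] = 1" using k0 by (simp add: one_pCons)
    hence hinv: "h * of_pol [:1/k:] = 1"
      unfolding hk by (simp flip: to_ac_mult to_fract_mult)
    show "J1 = J"
    proof (rule subset_antisym; rule subsetI)
      fix u assume "u \<in> J1"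
      thus "u \<in> J" unfolding J1_eq hk using nonzero_idealD(4)[OF J_ideal max_order_of_pol] by blast
    next
      fix u assume "u \<in> J"
      hence "of_pol [:1/k:] * u \<in> J" by (rule nonzero_idealD(4)[OF J_ideal max_order_of_pol])
      moreover have "u = h * (of_pol [:1/k:] * u)" unfolding mult.assoc[symmetric] hinv by simp
      ultimately show "u \<in> J1" unfolding J1_eq by (rule image_eqI[rotated])
    qed
  qed
  have "J' = J" if J': "distinguished y J'" "same_class y J' \<aa>" for J'
  proof -
    have J'_ideal: "nonzero_ideal y J'" using J'(1) by (simp add: distinguished_def)
    obtain h where h: "h \<in> function_field y" "h \<noteq> 0" and "J' = ideal_mult (principal y h) \<aa>"
      using J'(2) unfolding same_class_def by blast
    hence J'_eq: "J' = (\<lambda>u. h * u) ` \<aa>"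
      using ideal_mult_principal[OF order_module_ideal[OF a]] by simp
    have "J' = (\<lambda>u. (h / g) * u) ` J" using g0 unfolding J'_eq J_eq by (simp add: image_image)
    hence 1: "same_class y J' J"
      unfolding same_class_def ideal_mult_principal[OF order_module_ideal[OF J_ideal]]
      using function_field_divide[OF h(1) gF] h(2) g0 by (intro bexI[of _ "h / g"]) auto
    have "J = (\<lambda>u. (g / h) * u) ` J'" using h(2) unfolding J'_eq J_eq by (simp add: image_image)
    hence 2: "same_class y J J'"
      unfolding same_class_def ideal_mult_principal[OF order_module_ideal[OF J'_ideal]]
      using function_field_divide[OF gF h(1)] h(2) g0 by (intro bexI[of _ "g / h"]) auto
    show ?thesis
    proof (cases "degree (ideal_norm y J') \<le> degree (ideal_norm y J)")
      case True
      thus ?thesis using dist J'_ideal 1 unfolding distinguished_def by blast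
    next
      case False
      hence "degree (ideal_norm y J) \<le> degree (ideal_norm y J')" by simp
      hence "J = J'" using J'(1) J_ideal 2 unfolding distinguished_def by blast
      thus ?thesis ..
    qed
  qed
  thus ?thesis unfolding is_distinguished_ideal_of_class_def using dist same by blast
qed

end

theorem mainTheorem6:
  fixes A B I i F s :: "'k::{field,finite} poly"
    and y \<alpha> :: "'k rf_closure"
    and \<aa>\<^sub>1 \<aa>\<^sub>2 \<aa>\<^sub>3 \<aa>\<^sub>3' J :: "'k rf_closure set"
  assumes q: "\<exists>n>0. CARD('k) = 3 ^ n"
    and A: "A \<noteq> 0"
    and irred: "absolutely_irreducible (cubic A B)"
    and y: "y ^ 3 - of_pol A * y + of_pol B = 0"
    and std: "standard_form A B"
    and I: "is_index y I"
    and F: "F * I ^ 2 = i ^ 3 - i * A + B"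
    and deg: "2 * degree B > 3 * degree A"
    and deg': "\<not> 3 dvd degree (F * I ^ 2)"
    and ideals: "nonzero_ideal y \<aa>\<^sub>1" "nonzero_ideal y \<aa>\<^sub>2"
    and a3: "\<aa>\<^sub>3 = ideal_mult \<aa>\<^sub>1 \<aa>\<^sub>2"
    and s: "lead_coeff s = 1" "{p. of_pol p \<in> \<aa>\<^sub>3} = {p. s dvd p}"
    and a3': "\<aa>\<^sub>3' = ideal_mult (principal y (of_pol s)) (ideal_inverse y \<aa>\<^sub>3)"
    and \<alpha>: "\<alpha> \<in> \<aa>\<^sub>3'" "\<alpha> \<noteq> 0"
    and \<alpha>_min: "\<forall>\<beta>\<in>\<aa>\<^sub>3'. \<beta> \<noteq> 0 \<longrightarrow> rf_degree (field_norm y \<alpha>) \<le> rf_degree (field_norm y \<beta>)"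
    and J: "J = ideal_mult (principal y \<alpha>) (ideal_inverse y \<aa>\<^sub>3')"
  shows "is_distinguished_ideal_of_class y J (ideal_mult \<aa>\<^sub>1 \<aa>\<^sub>2)"
proof -
  obtain b where b: "is_pol_basis b (max_order y)" using I unfolding is_index_def by blast
  obtain n where "CARD('k) = 3 ^ n" using q by blast
  hence two: "(2::'k) \<noteq> 0" by (rule two_neq_0_if_card_power_3)
  have B: "\<not> 3 dvd degree B" using std deg unfolding standard_form_def by auto
  interpret ramified_cubic A B y b
    by unfold_locales (use y B deg two b in auto)
  have "nonzero_ideal y \<aa>\<^sub>3" unfolding a3 by (rule nonzero_ideal_mult[OF ideals])
  moreover have "s \<noteq> 0" using s(1) by auto
  ultimately have "is_distinguished_ideal_of_class y J \<aa>\<^sub>3"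
    using a3' \<alpha> \<alpha>_min J by (intro minimal_element_distinguished) (auto simp: norm_degree_def)
  thus ?thesis unfolding a3 .
qed

end
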